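(* Let $(\mathcal{A},\equiv_A)$ be an equivalence family and $\epsilon_A:I(\textit{er}(\mathcal{A}))\to(\mathcal{A},\equiv_A)$ the map $p\mapsto\max(p)$. For every event structure with equivalence $Q$ and every map $f:I(Q)\to(\mathcal{A},\equiv_A)$ of equivalence families, there is a map $h:Q\to\textit{er}(\mathcal{A})$ of event structures with equivalence such that $f=\epsilon_A\circ I(h)$. Moreover, if $h':Q\to\textit{er}(\mathcal{A})$ is a map of event structures with equivalence such that $f\equiv\epsilon_A\circ I(h')$, then $h'\equiv h$.
   Context: A family of configurations is a non-empty family $\mathcal{A}$ of sets such that (a) if $X\subseteq\mathcal{A}$ is finitely compatible (every finite subset of $X$ is contained in some member of $\mathcal{A}$) then $\bigcup X\in\mathcal{A}$; (b) if $e\in x\in\mathcal{A}$ there are $e_1,\dots,e_n\in x$ with $e_n=e$ and $\{e_1,\dots,e_i\}\in\mathcal{A}$ for all $i\leq n$. An equivalence family (ef) $(\mathcal{A},\equiv_A)$ is a family of configurations with an equivalence relation $\equiv_A$ on $A=\bigcup\mathcal{A}$. A map of ef's $f:(\mathcal{A},\equiv_A)\to(\mathcal{B},\equiv_B)$ is a partial function $f:A\rightharpoonup B$ preserving $\equiv$ (if $a_1\equiv_A a_2$ then $f(a_1),f(a_2)$ are both undefined or both defined with $f(a_1)\equiv_B f(a_2)$) such that for all $x\in\mathcal{A}$, $fx\in\mathcal{B}$ and for all $a_1,a_2\in x$ with $f(a_1),f(a_2)$ defined, $f(a_1)\equiv_B f(a_2)$ implies $a_1\equiv_A a_2$. Two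 maps $f_1,f_2$ are equivalent, $f_1\equiv f_2$, if they are defined on the same arguments and $f_1(a)\equiv_B f_2(a)$ wherever defined. A prime event structure $(P,\leq,\textrm{Con})$: a set with partial order $\leq$ and non-empty set $\textrm{Con}$ of finite subsets with $[p]=\{p'\mid p'\leq p\}$ finite, $\{p\}\in\textrm{Con}$, $\textrm{Con}$ closed under subsets, and $X\in\textrm{Con}$, $p\leq p'\in X\Rightarrow X\cup\{p\}\in\textrm{Con}$; its configurations are the down-closed subsets all of whose finite subsets are in $\textrm{Con}$. An event structure with equivalence (ese) is a prime event structure with an equivalence relation $\equiv$ on its events; $I(P)$ is the ef (configurations of $P$, $\equiv_P$); a map of ese's $P\to Q$ is a map of ef's $I(P)\to I(Q)$, and $I(h)=h$ on maps; equivalence of ese maps is as for ef maps. Realisations of $\mathcal{A}$: a partial order $(R,\leq)$ with finite down-sets $\{e'\mid e'\leq e\}$ and $\rho:R\to A$ with $\rho x\in\mathcal{A}$ for each down-closed $x$; a map of realisations from $\rho$ to $\rho'$ is a partial surjective function between carriers sending down-closed sets to down-closed sets and commuting with the $\rho$'s where defined; $\rho'\preceq\rho$ if such a map from $\rho$ to $\rho'$ exists; isomorphisms are bijective total maps with inverse a map; $\rho$ is extremal if every total map out of it is an isomorphism; prime extremal if its carrier also has a greatest element, whose image is $\max(\rho)$. $\textit{er}(\mathcal{A})=(P,\textrm{Con}_P,\leq_P,\equiv_P)$: $P$ is a choice of one representative from each isomorphism class of prime extremal realisations; $\leq_P$ is $\preceq$; $X\in\textrm{Con}_P$ iff $X\subseteq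 P$ finite with $\max[X]_P\in\mathcal{A}$ ($[X]_P$ the $\leq_P$-down-closure); $p_1\equiv_P p_2$ iff $\max(p_1)\equiv_A\max(p_2)$. *)

theory Defs
  imports "HOL-Library.Infinite_Typeclass"
begin

subsection \<open>Equivalence families and their maps\<close>

definition finitely_compatible :: "'a set set \<Rightarrow> 'a set set \<Rightarrow> bool" where
  "finitely_compatible \<A> X \<longleftrightarrow>
     (\<forall>Z. Z \<subseteq> X \<and> finite Z \<longrightarrow> (\<exists>y\<in>\<A>. \<forall>z\<in>Z. z \<subseteq> y))"

definition configuration_family :: "'a set set \<Rightarrow> bool" where
  "configuration_family \<A> \<longleftrightarrow>
     \<A> \<noteq> {} \<and>
     (\<forall>X. X \<subseteq> \<A> \<and> finitely_compatible \<A> X \<longrightarrow> \<Union>X \<in> \<A>) \<and>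
     (\<forall>x\<in>\<A>. \<forall>e\<in>x. \<exists>es. es \<noteq> [] \<and> set es \<subseteq> x \<and> last es = e \<and>
        (\<forall>i\<le>length es. set (take i es) \<in> \<A>))"

type_synonym 'a ef = "'a set set \<times> 'a rel"

definition equivalence_family :: "'a ef \<Rightarrow> bool" where
  "equivalence_family = (\<lambda>(\<A>, E). configuration_family \<A> \<and> equiv (\<Union>\<A>) E)"

definition pimage :: "('a \<rightharpoonup> 'b) \<Rightarrow> 'a set \<Rightarrow> 'b set" where
  "pimage f x = {b. \<exists>a\<in>x. f a = Some b}"

definition ef_map :: "'a ef \<Rightarrow> 'b ef \<Rightarrow> ('a \<rightharpoonup> 'b) \<Rightarrow> bool" where
  "ef_map = (\<lambda>(\<A>, E\<^sub>A) (\<B>, E\<^sub>B) f.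
     equivalence_family (\<A>, E\<^sub>A) \<and> equivalence_family (\<B>, E\<^sub>B) \<and>
     dom f \<subseteq> \<Union>\<A> \<and> ran f \<subseteq> \<Union>\<B> \<and>
     (\<forall>a\<^sub>1 a\<^sub>2. (a\<^sub>1, a\<^sub>2) \<in> E\<^sub>A \<longrightarrow> rel_option (\<lambda>b\<^sub>1 b\<^sub>2. (b\<^sub>1, b\<^sub>2) \<in> E\<^sub>B) (f a\<^sub>1) (f a\<^sub>2)) \<and>
     (\<forall>x\<in>\<A>. pimage f x \<in> \<B> \<and>
        (\<forall>a\<^sub>1\<in>x. \<forall>a\<^sub>2\<in>x. \<forall>b\<^sub>1 b\<^sub>2. f a\<^sub>1 = Some b\<^sub>1 \<and> f a\<^sub>2 = Some b\<^sub>2 \<and> (b\<^sub>1, b\<^sub>2) \<in> E\<^sub>B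
           \<longrightarrow> (a\<^sub>1, a\<^sub>2) \<in> E\<^sub>A)))"

text \<open>The argument is the equivalence relation of the common codomain.\<close>

definition maps_equiv :: "'b rel \<Rightarrow> ('a \<rightharpoonup> 'b) \<Rightarrow> ('a \<rightharpoonup> 'b) \<Rightarrow> bool" where
  "maps_equiv E\<^sub>B f\<^sub>1 f\<^sub>2 \<longleftrightarrow> (\<forall>a. rel_option (\<lambda>b\<^sub>1 b\<^sub>2. (b\<^sub>1, b\<^sub>2) \<in> E\<^sub>B) (f\<^sub>1 a) (f\<^sub>2 a))"


subsection \<open>Event structures with equivalence\<close>

definition down_closed :: "'r set \<Rightarrow> 'r rel \<Rightarrow> 'r set \<Rightarrow> bool" where
  "down_closed R le x \<longleftrightarrow> x \<subseteq> R \<and> (\<forall>e\<in>x. \<forall>e'. (e', e) \<in> le \<longrightarrow> e' \<in> x)"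

definition down_closure :: "'r rel \<Rightarrow> 'r set \<Rightarrow> 'r set" where
  "down_closure le X = {e'. \<exists>e\<in>X. (e', e) \<in> le}"

record 'p ese =
  events :: "'p set"
  causal :: "'p rel"
  Con :: "'p set set"
  eqv :: "'p rel"

definition prime_event_structure :: "'p set \<Rightarrow> 'p rel \<Rightarrow> 'p set set \<Rightarrow> bool" where
  "prime_event_structure P le C \<longleftrightarrow>
     partial_order_on P le \<and>
     C \<noteq> {} \<and> (\<forall>X\<in>C. finite X \<and> X \<subseteq> P) \<and>
     (\<forall>p\<in>P. finite {p'. (p', p) \<in> le}) \<and>
     (\<forall>p\<in>P. {p} \<in> C) \<and>
     (\<forall>X Y. Y \<subseteq> X \<and> X \<in> C \<longrightarrow> Y \<in> C) \<and>
     (\<forall>X p p'. X \<in> C \<and> (p, p') \<in> le \<and> p' \<in> X \<longrightarrow> X \<union> {p} \<in> C)"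

definition is_ese :: "'p ese \<Rightarrow> bool" where
  "is_ese Q \<longleftrightarrow>
     prime_event_structure (events Q) (causal Q) (Con Q) \<and> equiv (events Q) (eqv Q)"

definition configurations :: "'p ese \<Rightarrow> 'p set set" where
  "configurations Q =
     {x. down_closed (events Q) (causal Q) x \<and> (\<forall>X. X \<subseteq> x \<and> finite X \<longrightarrow> X \<in> Con Q)}"

definition I_ef :: "'p ese \<Rightarrow> 'p ef" where
  "I_ef Q = (configurations Q, eqv Q)"

definition ese_map :: "'p ese \<Rightarrow> 'q ese \<Rightarrow> ('p \<rightharpoonup> 'q) \<Rightarrow> bool" where
  "ese_map P Q h \<longleftrightarrow> is_ese P \<and> is_ese Q \<and> ef_map (I_ef P) (I_ef Q) h"


subsection \<open>Realisations\<close>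

record ('r, 'a) realisation =
  car :: "'r set"
  ord :: "'r rel"
  lab :: "'r \<Rightarrow> 'a"

definition is_realisation :: "'a set set \<Rightarrow> ('r, 'a) realisation \<Rightarrow> bool" where
  "is_realisation \<A> \<rho> \<longleftrightarrow>
     partial_order_on (car \<rho>) (ord \<rho>) \<and>
     (\<forall>e\<in>car \<rho>. finite {e'. (e', e) \<in> ord \<rho>}) \<and>
     lab \<rho> ` car \<rho> \<subseteq> \<Union>\<A> \<and>
     (\<forall>x. down_closed (car \<rho>) (ord \<rho>) x \<longrightarrow> lab \<rho> ` x \<in> \<A>)"

definition realisation_map ::
    "('r, 'a) realisation \<Rightarrow> ('s, 'a) realisation \<Rightarrow> ('r \<rightharpoonup> 's) \<Rightarrow> bool" where
  "realisation_map \<rho> \<rho>' g \<longleftrightarrow>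
     dom g \<subseteq> car \<rho> \<and> ran g = car \<rho>' \<and>
     (\<forall>x. down_closed (car \<rho>) (ord \<rho>) x \<longrightarrow> down_closed (car \<rho>') (ord \<rho>') (pimage g x)) \<and>
     (\<forall>e e'. g e = Some e' \<longrightarrow> lab \<rho> e = lab \<rho>' e')"

definition total_realisation_map ::
    "('r, 'a) realisation \<Rightarrow> ('s, 'a) realisation \<Rightarrow> ('r \<rightharpoonup> 's) \<Rightarrow> bool" where
  "total_realisation_map \<rho> \<rho>' g \<longleftrightarrow> realisation_map \<rho> \<rho>' g \<and> dom g = car \<rho>"

definition realisation_iso ::
    "('r, 'a) realisation \<Rightarrow> ('s, 'a) realisation \<Rightarrow> ('r \<rightharpoonup> 's) \<Rightarrow> bool" where
  "realisation_iso \<rho> \<rho>' g \<longleftrightarrow>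
     total_realisation_map \<rho> \<rho>' g \<and> inj_on g (car \<rho>) \<and>
     (\<exists>g'. realisation_map \<rho>' \<rho> g' \<and>
        g' \<circ>\<^sub>m g = Some |` car \<rho> \<and> g \<circ>\<^sub>m g' = Some |` car \<rho>')"

definition isomorphic :: "('r, 'a) realisation \<Rightarrow> ('s, 'a) realisation \<Rightarrow> bool" where
  "isomorphic \<rho> \<rho>' \<longleftrightarrow> (\<exists>g. realisation_iso \<rho> \<rho>' g)"

definition below :: "('s, 'a) realisation \<Rightarrow> ('r, 'a) realisation \<Rightarrow> bool" (infix "\<preceq>" 50) where
  "\<rho>' \<preceq> \<rho> \<longleftrightarrow> (\<exists>g. realisation_map \<rho> \<rho>' g)"

text \<open>
  In \<open>extremal\<close> the target \<open>\<rho>'\<close> has its carrier in the same type as \<open>\<rho>\<close>. As maps are surjective,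
  this gives the property for targets over every type: see \<open>extremal_any_target\<close>.
\<close>

definition extremal :: "'a set set \<Rightarrow> ('r, 'a) realisation \<Rightarrow> bool" where
  "extremal \<A> \<rho> \<longleftrightarrow>
     is_realisation \<A> \<rho> \<and>
     (\<forall>(\<rho>' :: ('r, 'a) realisation) g.
        is_realisation \<A> \<rho>' \<and> total_realisation_map \<rho> \<rho>' g \<longrightarrow> realisation_iso \<rho> \<rho>' g)"

definition is_greatest :: "('r, 'a) realisation \<Rightarrow> 'r \<Rightarrow> bool" where
  "is_greatest \<rho> t \<longleftrightarrow> t \<in> car \<rho> \<and> (\<forall>e\<in>car \<rho>. (e, t) \<in> ord \<rho>)"

definition prime_extremal :: "'a set set \<Rightarrow> ('r, 'a) realisation \<Rightarrow> bool" where
  "prime_extremal \<A> \<rho> \<longleftrightarrow> extremal \<A> \<rho> \<and> (\<exists>t. is_greatest \<rho> t)"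

definition rmax :: "('r, 'a) realisation \<Rightarrow> 'a" where
  "rmax \<rho> = lab \<rho> (THE t. is_greatest \<rho> t)"


subsection \<open>The event structure with equivalence of prime extremal realisations\<close>

text \<open>
  A prime extremal realisation has a finite carrier, so every isomorphism class of them has a member
  with carrier in any given infinite type \<open>'r\<close>: see \<open>prime_extremal_any_type\<close>.
\<close>

definition is_choice_of_representatives ::
    "'a set set \<Rightarrow> ('r::infinite, 'a) realisation set \<Rightarrow> bool" where
  "is_choice_of_representatives \<A> P \<longleftrightarrow>
     (\<forall>p\<in>P. prime_extremal \<A> p) \<and>
     (\<forall>\<rho> :: ('r, 'a) realisation. prime_extremal \<A> \<rho> \<longrightarrow> (\<exists>!p. p \<in> P \<and> isomorphic \<rho> p))"

definition er_le :: "('r, 'a) realisation set \<Rightarrow> ('r, 'a) realisation rel" where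
  "er_le P = {(p', p). p' \<in> P \<and> p \<in> P \<and> p' \<preceq> p}"

definition er :: "'a ef \<Rightarrow> ('r::infinite, 'a) realisation set \<Rightarrow> ('r, 'a) realisation ese" where
  "er = (\<lambda>(\<A>, E) P.
     \<lparr> events = P,
       causal = er_le P,
       Con = {X. finite X \<and> X \<subseteq> P \<and> rmax ` down_closure (er_le P) X \<in> \<A>},
       eqv = {(p\<^sub>1, p\<^sub>2). p\<^sub>1 \<in> P \<and> p\<^sub>2 \<in> P \<and> (rmax p\<^sub>1, rmax p\<^sub>2) \<in> E} \<rparr>)"

definition er_counit :: "('r, 'a) realisation set \<Rightarrow> ('r, 'a) realisation \<rightharpoonup> 'a" where
  "er_counit P = (\<lambda>p. if p \<in> P then Some (rmax p) else None)"


subsection \<open>Independence of the type of carriers\<close>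

lemma pimage_comp: "pimage (g' \<circ>\<^sub>m g) x = pimage g' (pimage g x)"
  by (auto simp: pimage_def map_comp_Some_iff)

lemma realisation_map_comp:
  assumes g: "realisation_map \<rho> \<rho>' g" and g': "realisation_map \<rho>' \<rho>'' g'"
  shows "realisation_map \<rho> \<rho>'' (g' \<circ>\<^sub>m g)"
proof -
  have "ran (g' \<circ>\<^sub>m g) = car \<rho>''"
  proof (intro equalityI subsetI)
    fix c assume "c \<in> ran (g' \<circ>\<^sub>m g)"
    then show "c \<in> car \<rho>''"
      using g' by (force simp: realisation_map_def ran_def map_comp_Some_iff)
  next
    fix c assume "c \<in> car \<rho>''"
    then obtain b where b: "g' b = Some c"
      using g' by (force simp: realisation_map_def ran_def)
    then have "b \<in> ran g"
      using g g' by (auto simp: realisation_map_def)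
    then obtain a where "g a = Some b"
      by (auto simp: ran_def)
    with b have "(g' \<circ>\<^sub>m g) a = Some c"
      by simp
    then show "c \<in> ran (g' \<circ>\<^sub>m g)"
      by (rule ranI)
  qed
  moreover have "dom (g' \<circ>\<^sub>m g) \<subseteq> car \<rho>"
    using g by (auto simp: realisation_map_def dom_def map_comp_Some_iff)
  ultimately show ?thesis
    using g g' unfolding realisation_map_def pimage_comp map_comp_Some_iff by metis
qed

lemma realisation_isoI:
  assumes g: "realisation_map \<rho> \<rho>' g" and g': "realisation_map \<rho>' \<rho> g'"
    and l: "g' \<circ>\<^sub>m g = Some |` car \<rho>" and r: "g \<circ>\<^sub>m g' = Some |` car \<rho>'"
  shows "realisation_iso \<rho> \<rho>' g"
proof -
  have ex: "\<exists>b. g e = Some b \<and> g' b = Some e" if "e \<in> car \<rho>" for e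
  proof -
    have "(g' \<circ>\<^sub>m g) e = Some e"
      using that by (simp add: l)
    then show ?thesis
      by (simp add: map_comp_Some_iff)
  qed
  have "dom g = car \<rho>"
    using g ex by (force simp: realisation_map_def)
  moreover have "inj_on g (car \<rho>)"
    by (rule inj_onI) (metis ex option.inject)
  ultimately show ?thesis
    using assms by (auto simp: realisation_iso_def total_realisation_map_def)
qed

lemma realisation_isoE:
  assumes "realisation_iso \<rho> \<rho>' g"
  obtains g' where "realisation_map \<rho> \<rho>' g" "realisation_map \<rho>' \<rho> g'"
    "g' \<circ>\<^sub>m g = Some |` car \<rho>" "g \<circ>\<^sub>m g' = Some |` car \<rho>'"
    "realisation_iso \<rho>' \<rho> g'"
  using assms realisation_isoI
  by (metis realisation_iso_def total_realisation_map_def)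

lemma map_comp_assoc': "f \<circ>\<^sub>m (g \<circ>\<^sub>m h) = (f \<circ>\<^sub>m g) \<circ>\<^sub>m h"
  by (rule ext) (auto simp: map_comp_def split: option.splits)

lemma map_comp_restrict_left:
  "ran g \<subseteq> A \<Longrightarrow> (Some |` A) \<circ>\<^sub>m g = g"
  by (rule ext) (auto simp: map_comp_def restrict_map_def ran_def split: option.splits)

lemma map_comp_restrict_right:
  assumes "dom g \<subseteq> A"
  shows "g \<circ>\<^sub>m (Some |` A) = g"
proof
  fix x
  show "(g \<circ>\<^sub>m (Some |` A)) x = g x"
  proof (cases "x \<in> A")
    case False
    with assms have "g x = None"
      by blast
    with False show ?thesis
      by simp
  qed simp
qed

lemma realisation_iso_comp:
  assumes "realisation_iso \<rho> \<rho>' g" and "realisation_iso \<rho>' \<rho>'' k"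
  shows "realisation_iso \<rho> \<rho>'' (k \<circ>\<^sub>m g)"
proof -
  obtain g' where g: "realisation_map \<rho> \<rho>' g" "realisation_map \<rho>' \<rho> g'"
    "g' \<circ>\<^sub>m g = Some |` car \<rho>" "g \<circ>\<^sub>m g' = Some |` car \<rho>'"
    using assms(1) by (rule realisation_isoE)
  obtain k' where k: "realisation_map \<rho>' \<rho>'' k" "realisation_map \<rho>'' \<rho>' k'"
    "k' \<circ>\<^sub>m k = Some |` car \<rho>'" "k \<circ>\<^sub>m k' = Some |` car \<rho>''"
    using assms(2) by (rule realisation_isoE)
  have "(g' \<circ>\<^sub>m k') \<circ>\<^sub>m (k \<circ>\<^sub>m g) = g' \<circ>\<^sub>m ((k' \<circ>\<^sub>m k) \<circ>\<^sub>m g)"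
    by (simp only: map_comp_assoc')
  also have "\<dots> = Some |` car \<rho>"
    using g by (simp add: k(3) map_comp_restrict_left realisation_map_def)
  finally have 1: "(g' \<circ>\<^sub>m k') \<circ>\<^sub>m (k \<circ>\<^sub>m g) = Some |` car \<rho>" .
  have "(k \<circ>\<^sub>m g) \<circ>\<^sub>m (g' \<circ>\<^sub>m k') = k \<circ>\<^sub>m ((g \<circ>\<^sub>m g') \<circ>\<^sub>m k')"
    by (simp only: map_comp_assoc')
  also have "\<dots> = Some |` car \<rho>''"
    using k by (simp add: g(4) map_comp_restrict_left realisation_map_def)
  finally show ?thesis
    using 1 g k by (intro realisation_isoI[where g' = "g' \<circ>\<^sub>m k'"] realisation_map_comp)
qed

definition transport :: "('r \<Rightarrow> 's) \<Rightarrow> ('r, 'a) realisation \<Rightarrow> ('s, 'a) realisation" where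
  "transport k \<rho> =
     \<lparr> car = k ` car \<rho>, ord = map_prod k k ` ord \<rho>, lab = lab \<rho> \<circ> inv_into (car \<rho>) k \<rparr>"

lemma transport:
  assumes k: "inj_on k (car \<rho>)" and \<rho>: "is_realisation \<A> \<rho>"
  shows "is_realisation \<A> (transport k \<rho>)"
    and "realisation_iso \<rho> (transport k \<rho>) (\<lambda>e. if e \<in> car \<rho> then Some (k e) else None)"
proof -
  have po: "ord \<rho> \<subseteq> car \<rho> \<times> car \<rho>" "refl_on (car \<rho>) (ord \<rho>)" "trans (ord \<rho>)" "antisym (ord \<rho>)"
    using \<rho> by (auto simp: is_realisation_def partial_order_on_def preorder_on_def)
  have ord_iff: "(a', k e) \<in> ord (transport k \<rho>) \<longleftrightarrow> (\<exists>e'. a' = k e' \<and> (e', e) \<in> ord \<rho>)"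
    if "e \<in> car \<rho>" for a' e
  proof
    assume "(a', k e) \<in> ord (transport k \<rho>)"
    then obtain e1 e2 where *: "(e1, e2) \<in> ord \<rho>" "a' = k e1" "k e = k e2"
      by (auto simp: transport_def)
    moreover from * have "e = e2"
      using that po(1) k by (auto dest: inj_onD)
    ultimately show "\<exists>e'. a' = k e' \<and> (e', e) \<in> ord \<rho>"
      by auto
  qed (auto simp: transport_def)
  have ord_iff': "(k e', k e) \<in> ord (transport k \<rho>) \<longleftrightarrow> (e', e) \<in> ord \<rho>"
    if "e \<in> car \<rho>" "e' \<in> car \<rho>" for e e'
    using that po(1) k ord_iff by (metis inj_on_eq_iff mem_Sigma_iff subsetD)
  have lab: "lab (transport k \<rho>) (k e) = lab \<rho> e" if "e \<in> car \<rho>" for e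
    using that k by (simp add: transport_def)
  have car: "car (transport k \<rho>) = k ` car \<rho>"
    by (simp add: transport_def)
  have dc: "down_closed (car (transport k \<rho>)) (ord (transport k \<rho>)) (k ` x)
      \<longleftrightarrow> down_closed (car \<rho>) (ord \<rho>) x" if x: "x \<subseteq> car \<rho>" for x
  proof
    assume *: "down_closed (car (transport k \<rho>)) (ord (transport k \<rho>)) (k ` x)"
    show "down_closed (car \<rho>) (ord \<rho>) x"
      unfolding down_closed_def
    proof (intro conjI x ballI allI impI)
      fix e e' assume e: "e \<in> x" "(e', e) \<in> ord \<rho>"
      then have "e' \<in> car \<rho>" "e \<in> car \<rho>" using po(1) by auto
      then have "k e' \<in> k ` x"
        using * e by (auto simp: down_closed_def ord_iff')
      then show "e' \<in> x"
        using k x \<open>e' \<in> car \<rho>\<close> by (auto simp: inj_on_def)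
    qed
  next
    assume *: "down_closed (car \<rho>) (ord \<rho>) x"
    show "down_closed (car (transport k \<rho>)) (ord (transport k \<rho>)) (k ` x)"
      unfolding down_closed_def
    proof (intro conjI ballI allI impI)
      show "k ` x \<subseteq> car (transport k \<rho>)" using x car by auto
      fix b a' assume "b \<in> k ` x" "(a', b) \<in> ord (transport k \<rho>)"
      then obtain e e' where "e \<in> x" "b = k e" "a' = k e'" "(e', e) \<in> ord \<rho>"
        using x ord_iff by blast
      with * show "a' \<in> k ` x" by (auto simp: down_closed_def)
    qed
  qed
  have "partial_order_on (car (transport k \<rho>)) (ord (transport k \<rho>))"
    unfolding partial_order_on_def preorder_on_def
  proof (intro conjI)
    show "ord (transport k \<rho>) \<subseteq> car (transport k \<rho>) \<times> car (transport k \<rho>)"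
      using po(1) by (auto simp: transport_def)
    then have sub: "\<exists>e\<in>car \<rho>. \<exists>e'\<in>car \<rho>. a = k e \<and> b = k e'"
      if "(a, b) \<in> ord (transport k \<rho>)" for a b
      using that car by auto
    show "refl_on (car (transport k \<rho>)) (ord (transport k \<rho>))"
      using po(2) by (auto simp: refl_on_def car ord_iff')
    show "trans (ord (transport k \<rho>))"
    proof (rule transI)
      fix a b c assume ab: "(a, b) \<in> ord (transport k \<rho>)" and bc: "(b, c) \<in> ord (transport k \<rho>)"
      obtain e2 e3 where e: "e2 \<in> car \<rho>" "e3 \<in> car \<rho>" "b = k e2" "c = k e3"
        using sub[OF bc] by auto
      obtain e1 where "a = k e1" "(e1, e2) \<in> ord \<rho>"
        using ab e ord_iff by blast
      moreover have "(e2, e3) \<in> ord \<rho>"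
        using bc e ord_iff' by blast
      ultimately have "(e1, e3) \<in> ord \<rho>"
        using po(3) by (meson transD)
      then show "(a, c) \<in> ord (transport k \<rho>)"
        using e \<open>a = k e1\<close> ord_iff by blast
    qed
    show "antisym (ord (transport k \<rho>))"
    proof (rule antisymI)
      fix a b assume ab: "(a, b) \<in> ord (transport k \<rho>)" and ba: "(b, a) \<in> ord (transport k \<rho>)"
      obtain e e' where e: "e \<in> car \<rho>" "e' \<in> car \<rho>" "a = k e" "b = k e'"
        using sub[OF ab] by auto
      then have "(e, e') \<in> ord \<rho>" "(e', e) \<in> ord \<rho>"
        using ab ba ord_iff' by blast+
      then show "a = b"
        using po(4) e by (auto dest: antisymD)
    qed
  qed
  moreover have "finite {e'. (e', b) \<in> ord (transport k \<rho>)}" if "b \<in> car (transport k \<rho>)" for b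
  proof -
    obtain e where e: "e \<in> car \<rho>" "b = k e"
      using \<open>b \<in> car (transport k \<rho>)\<close> car by auto
    then have "{e'. (e', b) \<in> ord (transport k \<rho>)} = k ` {e'. (e', e) \<in> ord \<rho>}"
      using ord_iff by auto
    then show ?thesis
      using \<rho> e by (simp add: is_realisation_def)
  qed
  moreover have "lab (transport k \<rho>) ` car (transport k \<rho>) \<subseteq> \<Union>\<A>"
    using \<rho> lab car by (auto simp: is_realisation_def)
  moreover have "lab (transport k \<rho>) ` y \<in> \<A>"
    if y: "down_closed (car (transport k \<rho>)) (ord (transport k \<rho>)) y" for y
  proof -
    obtain x where x: "x \<subseteq> car \<rho>" "y = k ` x"
      using y car by (auto simp: down_closed_def subset_image_iff)
    then have "lab (transport k \<rho>) ` y = lab \<rho> ` x"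
      using lab by (force simp: image_iff)
    then show ?thesis
      using x y dc \<rho> by (simp add: is_realisation_def)
  qed
  ultimately show real: "is_realisation \<A> (transport k \<rho>)"
    unfolding is_realisation_def by blast

  let ?g = "\<lambda>e. if e \<in> car \<rho> then Some (k e) else None"
  let ?g' = "\<lambda>b. if b \<in> k ` car \<rho> then Some (inv_into (car \<rho>) k b) else None"
  show "realisation_iso \<rho> (transport k \<rho>) ?g"
  proof (rule realisation_isoI[where g' = ?g'])
    have "pimage ?g x = k ` x" if "x \<subseteq> car \<rho>" for x
      using that by (auto simp: pimage_def)
    then have "down_closed (car (transport k \<rho>)) (ord (transport k \<rho>)) (pimage ?g x)"
      if "down_closed (car \<rho>) (ord \<rho>) x" for x
      using that dc by (metis down_closed_def)
    then show "realisation_map \<rho> (transport k \<rho>) ?g"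
      unfolding realisation_map_def by (auto simp: ran_def car lab split: if_splits)
    have im: "pimage ?g' (k ` x) = x" if "x \<subseteq> car \<rho>" for x
    proof -
      have "?g' (k e) = Some e" if "e \<in> x" for e
        using that k \<open>x \<subseteq> car \<rho>\<close> by (auto simp: subset_iff)
      then show ?thesis
        by (force simp: pimage_def)
    qed
    have ran: "ran ?g' = car \<rho>"
      using im[of "car \<rho>"] by (auto simp: ran_def pimage_def split: if_splits)
    have "down_closed (car \<rho>) (ord \<rho>) (pimage ?g' y)"
      if y: "down_closed (car (transport k \<rho>)) (ord (transport k \<rho>)) y" for y
    proof -
      obtain x where x: "x \<subseteq> car \<rho>" "y = k ` x"
        using y car by (auto simp: down_closed_def subset_image_iff)
      then show ?thesis
        using y dc im by simp
    qed
    then show "realisation_map (transport k \<rho>) \<rho> ?g'"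
      using ran unfolding realisation_map_def
      by (auto simp: car lab k split: if_splits)
    show "?g' \<circ>\<^sub>m ?g = Some |` car \<rho>" "?g \<circ>\<^sub>m ?g' = Some |` car (transport k \<rho>)"
      using k by (auto simp: fun_eq_iff map_comp_def restrict_map_def car)
  qed
qed

lemma extremal_any_target:
  fixes \<rho> :: "('r, 'a) realisation" and \<rho>' :: "('s, 'a) realisation"
  assumes ex: "extremal \<A> \<rho>" and \<rho>': "is_realisation \<A> \<rho>'" and g: "total_realisation_map \<rho> \<rho>' g"
  shows "realisation_iso \<rho> \<rho>' g"
proof -
  define k where "k b = (SOME e. g e = Some b)" for b
  have k: "g (k b) = Some b" if "b \<in> car \<rho>'" for b
  proof -
    have "\<exists>e. g e = Some b"
      using g that by (force simp: total_realisation_map_def realisation_map_def ran_def)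
    then show ?thesis
      unfolding k_def by (rule someI_ex)
  qed
  then have "inj_on k (car \<rho>')"
    by (metis inj_onI option.inject)
  note tr = transport[OF this \<rho>']
  let ?k = "\<lambda>b. if b \<in> car \<rho>' then Some (k b) else None"
  obtain k' where k': "realisation_map \<rho>' (transport k \<rho>') ?k" "k' \<circ>\<^sub>m ?k = Some |` car \<rho>'"
    "realisation_iso (transport k \<rho>') \<rho>' k'"
    using tr(2) by (rule realisation_isoE)
  have ran: "ran g = car \<rho>'" "dom g = car \<rho>"
    using g by (auto simp: total_realisation_map_def realisation_map_def)
  have "dom (?k \<circ>\<^sub>m g) = car \<rho>"
    using ran by (force simp: dom_def map_comp_def ran_def split: option.splits)
  then have "total_realisation_map \<rho> (transport k \<rho>') (?k \<circ>\<^sub>m g)"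
    using g k'(1) realisation_map_comp by (auto simp: total_realisation_map_def)
  then have "realisation_iso \<rho> (transport k \<rho>') (?k \<circ>\<^sub>m g)"
    using ex tr(1) by (auto simp: extremal_def)
  then have "realisation_iso \<rho> \<rho>' (k' \<circ>\<^sub>m (?k \<circ>\<^sub>m g))"
    using k'(3) by (rule realisation_iso_comp)
  then show ?thesis
    using ran by (simp only: map_comp_assoc' k'(2)) (simp add: map_comp_restrict_left)
qed

lemma extremal_isomorphic:
  fixes \<rho> :: "('r, 'a) realisation" and \<rho>' :: "('s, 'a) realisation"
  assumes ex: "extremal \<A> \<rho>" and \<rho>': "is_realisation \<A> \<rho>'" and g: "realisation_iso \<rho> \<rho>' g"
  shows "extremal \<A> \<rho>'"
  unfolding extremal_def
proof (intro conjI \<rho>' allI impI, elim conjE)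
  fix \<rho>'' :: "('s, 'a) realisation" and m
  assume \<rho>'': "is_realisation \<A> \<rho>''" and m: "total_realisation_map \<rho>' \<rho>'' m"
  obtain g' where g': "realisation_map \<rho> \<rho>' g" "g \<circ>\<^sub>m g' = Some |` car \<rho>'"
    "realisation_iso \<rho>' \<rho> g'"
    using g by (rule realisation_isoE)
  have *: "dom g = car \<rho>" "ran g = car \<rho>'" "dom m = car \<rho>'"
    using g m by (auto simp: realisation_iso_def total_realisation_map_def realisation_map_def)
  then have "dom (m \<circ>\<^sub>m g) = car \<rho>"
    by (force simp: dom_def map_comp_def ran_def split: option.splits)
  then have "total_realisation_map \<rho> \<rho>'' (m \<circ>\<^sub>m g)"
    using m g'(1) realisation_map_comp by (auto simp: total_realisation_map_def)
  then have "realisation_iso \<rho> \<rho>'' (m \<circ>\<^sub>m g)"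
    using ex \<rho>'' by (rule extremal_any_target[rotated 2])
  with g'(3) have "realisation_iso \<rho>' \<rho>'' ((m \<circ>\<^sub>m g) \<circ>\<^sub>m g')"
    by (rule realisation_iso_comp)
  then show "realisation_iso \<rho>' \<rho>'' m"
    using * by (simp only: map_comp_assoc'[symmetric] g'(2)) (simp add: map_comp_restrict_right)
qed

lemma prime_extremal_any_type:
  fixes \<rho> :: "('r, 'a) realisation"
  assumes "prime_extremal \<A> \<rho>"
  shows "\<exists>\<rho>' :: ('s::infinite, 'a) realisation. prime_extremal \<A> \<rho>' \<and> isomorphic \<rho> \<rho>'"
proof -
  obtain t where t: "is_greatest \<rho> t" and ex: "extremal \<A> \<rho>"
    using assms by (auto simp: prime_extremal_def)
  then have \<rho>: "is_realisation \<A> \<rho>"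
    by (simp add: extremal_def)
  with t have "finite {e'. (e', t) \<in> ord \<rho>}"
    by (simp add: is_realisation_def is_greatest_def)
  then have "finite (car \<rho>)"
    using t by (auto simp: is_greatest_def elim: finite_subset[rotated])
  then obtain k :: "'r \<Rightarrow> 's" where k: "inj_on k (car \<rho>)"
    using arb_inj_on_finite_infinite by blast
  note tr = transport[OF k \<rho>]
  have "is_greatest (transport k \<rho>) (k t)"
    using t by (force simp: is_greatest_def transport_def)
  then show ?thesis
    using extremal_isomorphic[OF ex tr] tr(2) by (auto simp: prime_extremal_def isomorphic_def)
qed

end

theory Submission
  imports Defs
begin

text \<open>
  A realisation is extremal iff it is tight: no event can be given a smaller strict down-set, and an
  event is determined by its label and its strict down-set. A partial map out of a tight realisation
  is an isomorphism from a down-closed part, and tight realisations are rigid. So the down-set of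
  \<open>p\<close> in \<open>er(\<A>)\<close>, labelled by \<open>max\<close>, is a copy of \<open>p\<close>, and \<open>er(\<A>)\<close> is itself tight.

  The lift \<open>h\<close> of \<open>f\<close> is built by well-founded recursion over \<open>Q\<close>. The images of the events below
  \<open>q\<close> form a finite down-closed set \<open>Y\<close> with \<open>max Y \<union> {f q} \<in> \<A>\<close>; a minimal down-closed \<open>X \<subseteq> Y\<close> with
  \<open>max X \<union> {f q} \<in> \<A>\<close> and a new greatest element labelled \<open>f q\<close> make up a prime extremal
  realisation, whose representative is \<open>h q\<close>.
\<close>

text \<open>Extremality quantifies over all realisations that receive a total map, which gives no
  hold for an induction; tightness asks about one event and its strict down-set at a time. It also
  makes sense for the whole order on \<open>P\<close>, which in general is not a realisation,
  because the labels of all of \<open>P\<close> need not form a member of \<open>\<A>\<close>.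
  Rigidity is accordingly stated for any tight finitary order, and rigidity inside \<open>P\<close>
  is what identifies the strict down-set of a new prime with the very set \<open>X\<close> it was
  built on, not merely with a copy of it. The set \<open>X\<close> is in general one of several
  minimal sets and can be smaller than \<open>Y\<close>. Hence the strict down-set of
  \<open>h q\<close> is only required to lie inside the image of the events below \<open>q\<close>,
  which is enough for \<open>h\<close> to send configurations to configurations. Different choices
  of \<open>X\<close> give different lifts with the same labels, and so uniqueness can be claimed
  only up to equivalence.\<close>

definition below_eq :: "'r rel \<Rightarrow> 'r \<Rightarrow> 'r set" where
  "below_eq le r = {e. (e, r) \<in> le}"

definition below_strict :: "'r rel \<Rightarrow> 'r \<Rightarrow> 'r set" where
  "below_strict le r = {e. (e, r) \<in> le \<and> e \<noteq> r}"

text \<open>The order-theoretic core common to realisations, event structures and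
  \<open>er_le P\<close>; isolating it lets the same well-foundedness argument serve all
  three.\<close>

definition finitary_order :: "'r set \<Rightarrow> 'r rel \<Rightarrow> bool" where
  "finitary_order R le \<longleftrightarrow> partial_order_on R le \<and> (\<forall>e\<in>R. finite (below_eq le e))"

lemma finitary_orderD:
  assumes "finitary_order R le"
  shows "le \<subseteq> R \<times> R" "\<And>r. r \<in> R \<Longrightarrow> (r, r) \<in> le"
    "\<And>a b c. (a, b) \<in> le \<Longrightarrow> (b, c) \<in> le \<Longrightarrow> (a, c) \<in> le"
    "\<And>a b. (a, b) \<in> le \<Longrightarrow> (b, a) \<in> le \<Longrightarrow> a = b"
    "\<And>a b. (a, b) \<in> le \<Longrightarrow> a \<in> R" "\<And>a b. (a, b) \<in> le \<Longrightarrow> b \<in> R"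
    "\<And>r. r \<in> R \<Longrightarrow> finite (below_eq le r)"
  using assms
  by (auto simp: finitary_order_def partial_order_on_def preorder_on_def refl_on_def
      dest: antisymD transD)

lemma finitary_orderI:
  assumes "le \<subseteq> R \<times> R" "\<And>r. r \<in> R \<Longrightarrow> (r, r) \<in> le"
    "\<And>a b c. (a, b) \<in> le \<Longrightarrow> (b, c) \<in> le \<Longrightarrow> (a, c) \<in> le"
    "\<And>a b. (a, b) \<in> le \<Longrightarrow> (b, a) \<in> le \<Longrightarrow> a = b"
    "\<And>r. r \<in> R \<Longrightarrow> finite (below_eq le r)"
  shows "finitary_order R le"
proof -
  have "trans le" "antisym le"
    by (rule transI, rule assms(3)) (auto intro: antisymI assms(4))
  then show ?thesis
    using assms(1,2,5)
    by (simp add: finitary_order_def partial_order_on_def preorder_on_def refl_on_def)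
qed

text \<open>The measure is the size of the principal down-set: it is finite, and passing to a
  strictly smaller element loses at least the larger element.\<close>

lemma wf_finitary_order:
  assumes "finitary_order R le"
  shows "wf {(a, b). (a, b) \<in> le \<and> a \<noteq> b}"
proof (rule wf_subset[OF wf_measure[of "\<lambda>r. card (below_eq le r)"]], clarify)
  fix a b assume ab: "(a, b) \<in> le" "a \<noteq> b"
  note D = finitary_orderD[OF assms]
  have "below_eq le a \<subseteq> below_eq le b"
    using ab D(3) by (auto simp: below_eq_def)
  moreover have "b \<in> below_eq le b" "b \<notin> below_eq le a"
    using ab D(2)[OF D(6)] D(4)[of a b] by (auto simp: below_eq_def)
  ultimately have "below_eq le a \<subset> below_eq le b"
    by blast
  then show "(a, b) \<in> measure (\<lambda>r. card (below_eq le r))"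
    using D(7)[OF D(6)[OF ab(1)]] by (simp add: psubset_card_mono)
qed

lemma finitary_order_induct [consumes 2, case_names less]:
  assumes "finitary_order R le" "r \<in> R"
    and step: "\<And>r. r \<in> R \<Longrightarrow> (\<And>s. (s, r) \<in> le \<Longrightarrow> s \<noteq> r \<Longrightarrow> P s) \<Longrightarrow> P r"
  shows "P r"
  using wf_finitary_order[OF assms(1)] assms(2)
proof (induction r rule: wf_induct_rule)
  case (less r)
  show ?case
  proof (rule step[OF less.prems])
    fix s assume "(s, r) \<in> le" "s \<noteq> r"
    then show "P s"
      using less.IH[of s] finitary_orderD(5)[OF assms(1)] by simp
  qed
qed

lemma down_closed_below_eq:
  "finitary_order R le \<Longrightarrow> down_closed R le (below_eq le r)"
  by (auto simp: down_closed_def below_eq_def dest: finitary_orderD(3,5))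

lemma down_closed_below_strict:
  assumes "finitary_order R le"
  shows "down_closed R le (below_strict le r)"
proof -
  note D = finitary_orderD[OF assms]
  show ?thesis
    by (auto simp: down_closed_def below_strict_def dest: D(3-5))
qed

lemma below_eq_insert:
  "finitary_order R le \<Longrightarrow> r \<in> R \<Longrightarrow> below_eq le r = insert r (below_strict le r)"
  by (auto simp: below_eq_def below_strict_def dest: finitary_orderD(2))

section \<open>Criteria for realisations and for their maps\<close>

lemma is_realisation_finitary: "is_realisation \<A> \<rho> \<Longrightarrow> finitary_order (car \<rho>) (ord \<rho>)"
  by (simp add: is_realisation_def finitary_order_def below_eq_def)

lemma is_realisation_down_closed:
  "is_realisation \<A> \<rho> \<Longrightarrow> down_closed (car \<rho>) (ord \<rho>) x \<Longrightarrow> lab \<rho> ` x \<in> \<A>"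
  by (simp add: is_realisation_def)

lemma is_realisation_car: "is_realisation \<A> \<rho> \<Longrightarrow> lab \<rho> ` car \<rho> \<in> \<A>"
  by (rule is_realisation_down_closed)
    (auto simp: down_closed_def dest: is_realisation_finitary finitary_orderD(5))

text \<open>A single upper bound \<open>z\<close> in the family witnesses compatibility of every
  finite subset of \<open>X\<close>.\<close>

lemma configuration_family_Union:
  assumes "configuration_family \<A>" "X \<subseteq> \<A>" "z \<in> \<A>" "\<Union>X \<subseteq> z"
  shows "\<Union>X \<in> \<A>"
proof -
  have "finitely_compatible \<A> X"
    using assms(3,4) by (auto simp: finitely_compatible_def)
  then show ?thesis
    using assms(1,2) by (simp add: configuration_family_def)
qed

lemma configuration_family_empty: "configuration_family \<A> \<Longrightarrow> {} \<in> \<A>"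
  using configuration_family_Union[of \<A> "{}"] by (auto simp: configuration_family_def)

text \<open>A down-closed set is the union of the principal down-sets of its elements, so its labels
  form a union of members bounded by \<open>z\<close>.\<close>

lemma image_down_closed_mem:
  assumes "configuration_family \<A>" "finitary_order R le" "down_closed R le x"
    and "\<And>e. e \<in> x \<Longrightarrow> l ` below_eq le e \<in> \<A>" and "z \<in> \<A>" "l ` x \<subseteq> z"
  shows "l ` x \<in> \<A>"
proof -
  have "l ` x = \<Union>((\<lambda>e. l ` below_eq le e) ` x)"
  proof (intro equalityI subsetI)
    fix a assume "a \<in> l ` x"
    then obtain e where "e \<in> x" "a = l e"
      by auto
    moreover have "e \<in> below_eq le e"
      using assms(2,3) \<open>e \<in> x\<close> by (auto simp: below_eq_def down_closed_def finitary_orderD(2))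
    ultimately show "a \<in> \<Union>((\<lambda>e. l ` below_eq le e) ` x)"
      by blast
  qed (use assms(3) in \<open>auto simp: down_closed_def below_eq_def\<close>)
  moreover have "\<Union>((\<lambda>e. l ` below_eq le e) ` x) \<in> \<A>"
    using assms(4,5,6) calculation by (intro configuration_family_Union[OF assms(1)]) auto
  ultimately show ?thesis
    by simp
qed

text \<open>
  By closure under bounded unions, only the principal down-sets and one upper bound of the labels
  have to be tested.
\<close>

lemma is_realisationI:
  assumes "configuration_family \<A>" "finitary_order (car \<rho>) (ord \<rho>)"
    and "\<And>e. e \<in> car \<rho> \<Longrightarrow> lab \<rho> ` below_eq (ord \<rho>) e \<in> \<A>" and "z \<in> \<A>" "lab \<rho> ` car \<rho> \<subseteq> z"
  shows "is_realisation \<A> \<rho>"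
proof -
  have "lab \<rho> ` x \<in> \<A>" if "down_closed (car \<rho>) (ord \<rho>) x" for x
    using that assms
    by (intro image_down_closed_mem[OF assms(1,2) that, of _ z]) (auto simp: down_closed_def)
  then show ?thesis
    using assms(2,4,5) by (auto simp: is_realisation_def finitary_order_def below_eq_def)
qed

text \<open>Preservation of down-closed sets is applied to the principal down-set of
  \<open>r\<close>. Predecessors thus lift backwards along a map; the order itself need not be
  preserved forwards.\<close>

lemma realisation_map_lift:
  assumes "realisation_map \<rho> \<rho>' g" "finitary_order (car \<rho>) (ord \<rho>)"
    and "g r = Some s" "(s', s) \<in> ord \<rho>'"
  shows "\<exists>r'. (r', r) \<in> ord \<rho> \<and> g r' = Some s'"
proof -
  have "r \<in> car \<rho>"
    using assms(1,3) by (auto simp: realisation_map_def)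
  then have "(r, r) \<in> ord \<rho>"
    using assms(2) by (simp add: finitary_orderD(2))
  then have "s \<in> pimage g (below_eq (ord \<rho>) r)"
    using assms(3) by (auto simp: pimage_def below_eq_def)
  moreover have "down_closed (car \<rho>') (ord \<rho>') (pimage g (below_eq (ord \<rho>) r))"
    using assms(1) down_closed_below_eq[OF assms(2)] by (auto simp: realisation_map_def)
  ultimately show ?thesis
    using assms(4) by (auto simp: down_closed_def pimage_def below_eq_def)
qed

text \<open>The converse of the lifting property: it turns the quantification over down-closed sets
  into a condition on single elements.\<close>

lemma realisation_mapI:
  assumes "dom g \<subseteq> car \<rho>" "ran g = car \<rho>'"
    and "\<And>r s s'. g r = Some s \<Longrightarrow> (s', s) \<in> ord \<rho>' \<Longrightarrow> \<exists>r'. (r', r) \<in> ord \<rho> \<and> g r' = Some s'"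
    and "\<And>r s. g r = Some s \<Longrightarrow> lab \<rho> r = lab \<rho>' s"
  shows "realisation_map \<rho> \<rho>' g"
  unfolding realisation_map_def
proof (intro conjI allI impI assms(1,2))
  fix x assume x: "down_closed (car \<rho>) (ord \<rho>) x"
  show "down_closed (car \<rho>') (ord \<rho>') (pimage g x)"
    unfolding down_closed_def
  proof (intro conjI ballI allI impI)
    show "pimage g x \<subseteq> car \<rho>'"
      using assms(2) by (auto simp: pimage_def ran_def)
    fix s s' assume "s \<in> pimage g x" "(s', s) \<in> ord \<rho>'"
    then show "s' \<in> pimage g x"
      using x assms(3) unfolding pimage_def down_closed_def by blast
  qed
qed (use assms(4) in auto)

subsection \<open>Order isomorphisms and restrictions\<close>

text \<open>A total function with order preserved and reflected is easier to restrict and to induct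
  over than a partial map with a partial inverse. Its values outside the carrier are
  arbitrary.\<close>

definition order_iso :: "('r, 'a) realisation \<Rightarrow> ('s, 'a) realisation \<Rightarrow> ('r \<Rightarrow> 's) \<Rightarrow> bool" where
  "order_iso \<rho> \<rho>' \<phi> \<longleftrightarrow>
     bij_betw \<phi> (car \<rho>) (car \<rho>') \<and>
     (\<forall>a\<in>car \<rho>. \<forall>b\<in>car \<rho>. (\<phi> a, \<phi> b) \<in> ord \<rho>' \<longleftrightarrow> (a, b) \<in> ord \<rho>) \<and>
     (\<forall>a\<in>car \<rho>. lab \<rho>' (\<phi> a) = lab \<rho> a)"

lemma order_iso_comp:
  assumes \<phi>: "order_iso \<rho> \<rho>' \<phi>" and \<psi>: "order_iso \<rho>' \<rho>'' \<psi>"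
  shows "order_iso \<rho> \<rho>'' (\<psi> \<circ> \<phi>)"
proof -
  have "\<phi> a \<in> car \<rho>'" if "a \<in> car \<rho>" for a
    using \<phi> that by (auto simp: order_iso_def bij_betw_def)
  moreover have "bij_betw (\<psi> \<circ> \<phi>) (car \<rho>) (car \<rho>'')"
    using \<phi> \<psi> unfolding order_iso_def by (metis bij_betw_trans)
  ultimately show ?thesis
    using \<phi> \<psi> by (simp add: order_iso_def)
qed

lemma order_iso_inv:
  assumes "order_iso \<rho> \<rho>' \<phi>"
  shows "order_iso \<rho>' \<rho> (inv_into (car \<rho>) \<phi>)"
proof -
  have b: "bij_betw \<phi> (car \<rho>) (car \<rho>')"
    using assms by (simp add: order_iso_def)
  let ?\<psi> = "inv_into (car \<rho>) \<phi>"
  have "?\<psi> a \<in> car \<rho>" "\<phi> (?\<psi> a) = a" if "a \<in> car \<rho>'" for a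
    using b that by (auto simp: bij_betw_def inv_into_into f_inv_into_f)
  then show ?thesis
    using assms bij_betw_inv_into[OF b] unfolding order_iso_def by metis
qed

lemma order_iso_map:
  assumes "order_iso \<rho> \<rho>' \<phi>" "ord \<rho>' \<subseteq> car \<rho>' \<times> car \<rho>'"
  shows "realisation_map \<rho> \<rho>' (\<lambda>e. if e \<in> car \<rho> then Some (\<phi> e) else None)"
proof (rule realisation_mapI)
  have b: "\<phi> ` car \<rho> = car \<rho>'"
    using assms by (simp add: order_iso_def bij_betw_def)
  then show "ran (\<lambda>e. if e \<in> car \<rho> then Some (\<phi> e) else None) = car \<rho>'"
    by (force simp: ran_def)
  fix r s s' assume "(if r \<in> car \<rho> then Some (\<phi> r) else None) = Some s" "(s', s) \<in> ord \<rho>'"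
  moreover from this obtain r' where "r' \<in> car \<rho>" "s' = \<phi> r'"
    using b assms(2) by blast
  ultimately show "\<exists>r'. (r', r) \<in> ord \<rho> \<and> (if r' \<in> car \<rho> then Some (\<phi> r') else None) = Some s'"
    using assms(1) unfolding order_iso_def by (auto split: if_splits)
qed (use assms in \<open>auto simp: order_iso_def split: if_splits\<close>)

lemma order_iso_isomorphic:
  assumes "order_iso \<rho> \<rho>' \<phi>" "ord \<rho> \<subseteq> car \<rho> \<times> car \<rho>" "ord \<rho>' \<subseteq> car \<rho>' \<times> car \<rho>'"
  shows "isomorphic \<rho> \<rho>'"
proof -
  have b: "bij_betw \<phi> (car \<rho>) (car \<rho>')"
    using assms by (simp add: order_iso_def)
  let ?g = "\<lambda>e. if e \<in> car \<rho> then Some (\<phi> e) else None"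
  let ?g' = "\<lambda>e. if e \<in> car \<rho>' then Some (inv_into (car \<rho>) \<phi> e) else None"
  have "?g' \<circ>\<^sub>m ?g = Some |` car \<rho>" "?g \<circ>\<^sub>m ?g' = Some |` car \<rho>'"
    using b by (auto simp: fun_eq_iff map_comp_def restrict_map_def bij_betw_def
        inv_into_into f_inv_into_f)
  then have "realisation_iso \<rho> \<rho>' ?g"
    using order_iso_map[OF assms(1,3)] order_iso_map[OF order_iso_inv[OF assms(1)] assms(2)]
    by (intro realisation_isoI[where g' = ?g'])
  then show ?thesis
    by (auto simp: isomorphic_def)
qed

text \<open>Maps only lift predecessors, so each direction of the order equivalence comes from a
  different map: reflection from lifting along \<open>g\<close>, preservation from lifting along its
  inverse \<open>g'\<close>.\<close>

lemma isomorphic_order_iso: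
  assumes "isomorphic \<rho> \<rho>'" "finitary_order (car \<rho>) (ord \<rho>)" "finitary_order (car \<rho>') (ord \<rho>')"
  shows "\<exists>\<phi>. order_iso \<rho> \<rho>' \<phi>"
proof -
  obtain g g' where g: "realisation_map \<rho> \<rho>' g" "realisation_map \<rho>' \<rho> g'"
    "g' \<circ>\<^sub>m g = Some |` car \<rho>" "g \<circ>\<^sub>m g' = Some |` car \<rho>'"
    using assms(1) unfolding isomorphic_def by (metis realisation_isoE)
  have gg: "\<exists>s. g r = Some s \<and> g' s = Some r" if "r \<in> car \<rho>" for r
  proof -
    have "(g' \<circ>\<^sub>m g) r = Some r"
      using that by (simp add: g(3))
    then show ?thesis
      by (simp add: map_comp_Some_iff)
  qed
  define \<phi> where "\<phi> r = the (g r)" for r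
  have \<phi>: "g r = Some (\<phi> r)" "g' (\<phi> r) = Some r" if "r \<in> car \<rho>" for r
    using gg[OF that] by (auto simp: \<phi>_def)
  have "inj_on \<phi> (car \<rho>)"
    by (rule inj_onI) (metis \<phi>(2) option.inject)
  moreover have "\<phi> ` car \<rho> = car \<rho>'"
  proof -
    have "ran g = car \<rho>'" "dom g \<subseteq> car \<rho>"
      using g(1) by (auto simp: realisation_map_def)
    moreover have "ran g = \<phi> ` dom g"
      by (force simp: ran_def \<phi>_def image_iff dom_def)
    moreover have "car \<rho> \<subseteq> dom g"
      using \<phi>(1) by blast
    ultimately show ?thesis
      by auto
  qed
  moreover have "(\<phi> a, \<phi> b) \<in> ord \<rho>' \<longleftrightarrow> (a, b) \<in> ord \<rho>" if ab: "a \<in> car \<rho>" "b \<in> car \<rho>" for a b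
  proof
    assume "(\<phi> a, \<phi> b) \<in> ord \<rho>'"
    then obtain a' where a': "(a', b) \<in> ord \<rho>" "g a' = Some (\<phi> a)"
      using realisation_map_lift[OF g(1) assms(2) \<phi>(1)[OF ab(2)]] by blast
    then have "a' \<in> car \<rho>"
      using finitary_orderD(5)[OF assms(2)] by simp
    then have "a' = a"
      using a' \<phi> ab by (metis option.inject)
    then show "(a, b) \<in> ord \<rho>"
      using a' by simp
  next
    assume "(a, b) \<in> ord \<rho>"
    then obtain c where c: "(c, \<phi> b) \<in> ord \<rho>'" "g' c = Some a"
      using realisation_map_lift[OF g(2) assms(3) \<phi>(2)[OF ab(2)]] by blast
    then have "c \<in> car \<rho>'"
      using finitary_orderD(5)[OF assms(3)] by simp
    then have "(g \<circ>\<^sub>m g') c = Some c"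
      by (simp add: g(4))
    then have "c = \<phi> a"
      using c ab \<phi> by simp
    then show "(\<phi> a, \<phi> b) \<in> ord \<rho>'"
      using c by simp
  qed
  moreover have "lab \<rho>' (\<phi> a) = lab \<rho> a" if "a \<in> car \<rho>" for a
    using \<phi>(1)[OF that] g(1) by (simp add: realisation_map_def)
  ultimately show ?thesis
    by (auto simp: order_iso_def bij_betw_def)
qed

lemma isomorphic_refl: "ord \<rho> \<subseteq> car \<rho> \<times> car \<rho> \<Longrightarrow> isomorphic \<rho> \<rho>"
  by (rule order_iso_isomorphic[where \<phi> = id]) (auto simp: order_iso_def)

lemma isomorphic_sym: "isomorphic \<rho> \<rho>' \<Longrightarrow> isomorphic \<rho>' \<rho>"
  unfolding isomorphic_def by (metis realisation_isoE)

lemma isomorphic_trans: "isomorphic \<rho> \<rho>' \<Longrightarrow> isomorphic \<rho>' \<rho>'' \<Longrightarrow> isomorphic \<rho> \<rho>''"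
  unfolding isomorphic_def using realisation_iso_comp by blast

lemma isomorphic_below: "isomorphic \<rho> \<rho>' \<Longrightarrow> \<rho>' \<preceq> \<rho>"
  unfolding isomorphic_def below_def by (metis realisation_isoE)

lemma below_trans: "\<rho>'' \<preceq> \<rho>' \<Longrightarrow> \<rho>' \<preceq> \<rho> \<Longrightarrow> \<rho>'' \<preceq> \<rho>"
  unfolding below_def using realisation_map_comp by blast

definition restriction :: "('r, 'a) realisation \<Rightarrow> 'r set \<Rightarrow> ('r, 'a) realisation" where
  "restriction \<rho> x = \<lparr> car = x, ord = ord \<rho> \<inter> x \<times> x, lab = lab \<rho> \<rparr>"

lemma restriction_simps [simp]:
  "car (restriction \<rho> x) = x" "ord (restriction \<rho> x) = ord \<rho> \<inter> x \<times> x"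
  "lab (restriction \<rho> x) = lab \<rho>"
  by (simp_all add: restriction_def)

lemma finitary_order_restriction:
  assumes "finitary_order R le" "x \<subseteq> R"
  shows "finitary_order x (le \<inter> x \<times> x)"
proof -
  note D = finitary_orderD[OF assms(1)]
  have "finite (below_eq (le \<inter> x \<times> x) r)" if "r \<in> x" for r
    by (rule finite_subset[OF _ D(7)[of r]]) (use that assms(2) in \<open>auto simp: below_eq_def\<close>)
  then show ?thesis
    using assms(2) by (intro finitary_orderI) (auto dest: D(2-4))
qed

lemma down_closed_restriction:
  assumes "down_closed R le x" "down_closed x (le \<inter> x \<times> x) y"
  shows "down_closed R le y"
  using assms unfolding down_closed_def by blast

lemma is_realisation_restriction:
  assumes "is_realisation \<A> \<rho>" "down_closed (car \<rho>) (ord \<rho>) x"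
  shows "is_realisation \<A> (restriction \<rho> x)"
proof -
  have "x \<subseteq> car \<rho>"
    using assms(2) by (simp add: down_closed_def)
  moreover from this have "lab \<rho> ` x \<subseteq> \<Union>\<A>"
    using assms(1) by (fastforce simp: is_realisation_def)
  ultimately show ?thesis
    using finitary_order_restriction[OF is_realisation_finitary[OF assms(1)]]
      down_closed_restriction[OF assms(2)] assms(1)
    by (simp add: is_realisation_def finitary_order_def below_eq_def)
qed

text \<open>The identity defined only on \<open>y\<close> is a map. This is where partiality of maps
  is essential: it allows events outside a down-closed part to be forgotten.\<close>

lemma restriction_below:
  assumes "down_closed (car \<rho>) (ord \<rho>) y" "y \<subseteq> x"
  shows "restriction \<rho> y \<preceq> restriction \<rho> x"
  unfolding below_def
proof (rule exI, rule realisation_mapI)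
  show "ran (Some |` y) = car (restriction \<rho> y)"
    by (auto simp: ran_def restrict_map_def)
  show "dom (Some |` y) \<subseteq> car (restriction \<rho> x)"
    using assms(2) by simp
  fix r s
  assume "(Some |` y) r = Some s"
  then have rs: "s = r" "r \<in> y"
    by (auto simp: restrict_map_def split: if_splits)
  then show "lab (restriction \<rho> x) r = lab (restriction \<rho> y) s"
    by simp
  fix s' assume "(s', s) \<in> ord (restriction \<rho> y)"
  then show "\<exists>r'. (r', r) \<in> ord (restriction \<rho> x) \<and> (Some |` y) r' = Some s'"
    using rs assms(2) by (intro exI[of _ s']) auto
qed

subsection \<open>Tightness\<close>

text \<open>Each clause looks only at strict down-sets and at the labels on them, so tightness
  passes to down-closed parts and can be stated for an order whose labels as a whole are not a
  configuration.\<close>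

definition tight :: "'a set set \<Rightarrow> ('r, 'a) realisation \<Rightarrow> bool" where
  "tight \<A> \<rho> \<longleftrightarrow>
     (\<forall>r\<in>car \<rho>. \<forall>X. down_closed (car \<rho>) (ord \<rho>) X \<and> X \<subseteq> below_strict (ord \<rho>) r \<and>
        insert (lab \<rho> r) (lab \<rho> ` X) \<in> \<A> \<longrightarrow> X = below_strict (ord \<rho>) r) \<and>
     (\<forall>r\<in>car \<rho>. \<forall>s\<in>car \<rho>. below_strict (ord \<rho>) r = below_strict (ord \<rho>) s \<and> lab \<rho> r = lab \<rho> s
        \<longrightarrow> r = s)"

lemma tight_minimal:
  assumes "tight \<A> \<rho>" "r \<in> car \<rho>" "down_closed (car \<rho>) (ord \<rho>) X"
    "X \<subseteq> below_strict (ord \<rho>) r" "insert (lab \<rho> r) (lab \<rho> ` X) \<in> \<A>"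
  shows "X = below_strict (ord \<rho>) r"
  using assms by (simp add: tight_def)

lemma tight_unique:
  assumes "tight \<A> \<rho>" "r \<in> car \<rho>" "s \<in> car \<rho>"
    "below_strict (ord \<rho>) r = below_strict (ord \<rho>) s" "lab \<rho> r = lab \<rho> s"
  shows "r = s"
  using assms by (simp add: tight_def)

lemma below_strict_restriction:
  assumes "down_closed R le x" "r \<in> x"
  shows "below_strict (le \<inter> x \<times> x) r = below_strict le r"
  using assms by (auto simp: down_closed_def below_strict_def)

lemma tight_restriction:
  assumes "tight \<A> \<rho>" "down_closed (car \<rho>) (ord \<rho>) x"
  shows "tight \<A> (restriction \<rho> x)"
  unfolding tight_def
proof (intro conjI ballI allI impI; elim conjE)
  fix r X
  assume r: "r \<in> car (restriction \<rho> x)"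
    and X: "down_closed (car (restriction \<rho> x)) (ord (restriction \<rho> x)) X"
    "X \<subseteq> below_strict (ord (restriction \<rho> x)) r"
    "insert (lab (restriction \<rho> x) r) (lab (restriction \<rho> x) ` X) \<in> \<A>"
  have "r \<in> car \<rho>"
    using r assms(2) by (auto simp: down_closed_def)
  moreover have "down_closed (car \<rho>) (ord \<rho>) X"
    using down_closed_restriction[OF assms(2)] X(1) by simp
  ultimately show "X = below_strict (ord (restriction \<rho> x)) r"
    using r X(2,3) by (simp add: tight_minimal[OF assms(1)] below_strict_restriction[OF assms(2)])
next
  fix r s
  assume "r \<in> car (restriction \<rho> x)" "s \<in> car (restriction \<rho> x)"
    "below_strict (ord (restriction \<rho> x)) r = below_strict (ord (restriction \<rho> x)) s"
    "lab (restriction \<rho> x) r = lab (restriction \<rho> x) s"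
  moreover have "x \<subseteq> car \<rho>"
    using assms(2) by (simp add: down_closed_def)
  ultimately show "r = s"
    using tight_unique[OF assms(1), of r s] by (auto simp: below_strict_restriction[OF assms(2)])
qed

text \<open>Induction on \<open>r\<close>. Let \<open>X\<close> be the part strictly below
  \<open>r\<close> on which \<open>g\<close> is defined with value strictly below \<open>s\<close>.
  The induction hypothesis makes \<open>X\<close> down-closed, and lifting along \<open>g\<close>
  shows that \<open>X\<close> carries exactly the labels found strictly below \<open>s\<close>. With
  \<open>r\<close> added, these are the labels of the down-set of \<open>s\<close>, a configuration,
  so minimality leaves nothing out of \<open>X\<close>.\<close>

lemma tight_map_strict_mono:
  assumes \<rho>: "is_realisation \<A> \<rho>" and \<rho>': "is_realisation \<A> \<rho>'" and t: "tight \<A> \<rho>"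
    and g: "realisation_map \<rho> \<rho>' g"
    and "g r = Some s" "(r', r) \<in> ord \<rho>" "r' \<noteq> r"
  shows "\<exists>s'. g r' = Some s' \<and> (s', s) \<in> ord \<rho>' \<and> s' \<noteq> s"
proof -
  note F = is_realisation_finitary[OF \<rho>] and F' = is_realisation_finitary[OF \<rho>']
  note D = finitary_orderD[OF F] and D' = finitary_orderD[OF F']
  have "r \<in> car \<rho>"
    using g \<open>g r = Some s\<close> by (auto simp: realisation_map_def)
  from F this
  have "\<forall>s r'. g r = Some s \<and> (r', r) \<in> ord \<rho> \<and> r' \<noteq> r \<longrightarrow>
      (\<exists>s'. g r' = Some s' \<and> (s', s) \<in> ord \<rho>' \<and> s' \<noteq> s)"
  proof (induction r rule: finitary_order_induct)
    case (less r)
    show ?case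
    proof (intro allI impI, elim conjE)
      fix s r' assume s: "g r = Some s" and r': "(r', r) \<in> ord \<rho>" "r' \<noteq> r"
      have sc: "s \<in> car \<rho>'"
        using g s by (auto simp: realisation_map_def ran_def)
      define X where "X = {u \<in> below_strict (ord \<rho>) r. \<exists>v. g u = Some v \<and> v \<in> below_strict (ord \<rho>') s}"
      have "down_closed (car \<rho>) (ord \<rho>) X"
        unfolding down_closed_def
      proof (intro conjI ballI allI impI)
        show "X \<subseteq> car \<rho>"
          by (auto simp: X_def below_strict_def D(5))
        fix u u' assume u: "u \<in> X" and u': "(u', u) \<in> ord \<rho>"
        show "u' \<in> X"
        proof (cases "u' = u")
          case False
          obtain v where v: "g u = Some v" "(v, s) \<in> ord \<rho>'" "v \<noteq> s"
            and ur: "(u, r) \<in> ord \<rho>" "u \<noteq> r"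
            using u by (auto simp: X_def below_strict_def)
          obtain v' where v': "g u' = Some v'" "(v', v) \<in> ord \<rho>'" "v' \<noteq> v"
            using less.IH[OF ur] v(1) u' False by blast
          have "(v', s) \<in> ord \<rho>'" "v' \<noteq> s"
            using v v' D'(3)[of v' v s] D'(4)[of v s] by auto
          moreover have "(u', r) \<in> ord \<rho>" "u' \<noteq> r"
            using u' ur D(3)[of u' u r] D(4)[of u r] by auto
          ultimately show ?thesis
            using v'(1) by (simp add: X_def below_strict_def)
        qed (use u in simp)
      qed
      moreover have "X \<subseteq> below_strict (ord \<rho>) r"
        by (auto simp: X_def)
      moreover have "insert (lab \<rho> r) (lab \<rho> ` X) \<in> \<A>"
      proof -
        have lab: "lab \<rho> u = lab \<rho>' v" if "g u = Some v" for u v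
          using g that by (simp add: realisation_map_def)
        have "lab \<rho> ` X = lab \<rho>' ` below_strict (ord \<rho>') s"
        proof (intro equalityI subsetI)
          fix a assume "a \<in> lab \<rho>' ` below_strict (ord \<rho>') s"
          then obtain v where v: "(v, s) \<in> ord \<rho>'" "v \<noteq> s" "a = lab \<rho>' v"
            by (auto simp: below_strict_def)
          then obtain u where "(u, r) \<in> ord \<rho>" "g u = Some v"
            using realisation_map_lift[OF g F s] by blast
          moreover from this have "u \<noteq> r"
            using s v(2) by auto
          ultimately have "u \<in> X" "a = lab \<rho> u"
            using v lab by (auto simp: X_def below_strict_def)
          then show "a \<in> lab \<rho> ` X"
            by blast
        qed (use lab in \<open>auto simp: X_def\<close>)
        then have "insert (lab \<rho> r) (lab \<rho> ` X) = lab \<rho>' ` below_eq (ord \<rho>') s"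
          using below_eq_insert[OF F' sc] lab[OF s] by simp
        then show ?thesis
          using is_realisation_down_closed[OF \<rho>' down_closed_below_eq[OF F']] by simp
      qed
      ultimately have "X = below_strict (ord \<rho>) r"
        using tight_minimal[OF t less.hyps] by blast
      then have "r' \<in> X"
        using r' by (simp add: below_strict_def)
      then show "\<exists>s'. g r' = Some s' \<and> (s', s) \<in> ord \<rho>' \<and> s' \<noteq> s"
        by (auto simp: X_def below_strict_def)
    qed
  qed
  then show ?thesis
    using assms by blast
qed

text \<open>Two events with the same image have the same label, and lifting together with the
  induction hypothesis gives them the same strict down-set. The uniqueness clause of tightness then
  identifies them.\<close>

lemma tight_map_inj:
  assumes \<rho>: "is_realisation \<A> \<rho>" and \<rho>': "is_realisation \<A> \<rho>'" and t: "tight \<A> \<rho>"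
    and g: "realisation_map \<rho> \<rho>' g"
    and "g r\<^sub>1 = Some s" "g r\<^sub>2 = Some s"
  shows "r\<^sub>1 = r\<^sub>2"
proof -
  note F = is_realisation_finitary[OF \<rho>] and F' = is_realisation_finitary[OF \<rho>']
  have car: "r \<in> car \<rho>" if "g r = Some s" for r s
    using g that by (auto simp: realisation_map_def)
  \<comment> \<open>The identification of smaller events is a hypothesis here because only the first
    of the two events descends in the induction. For the reverse inclusion the roles of
    \<open>a\<close> and \<open>b\<close> are exchanged, but the hypothesis is still discharged from
    the side of the first event.\<close>
  have half: "below_strict (ord \<rho>) a \<subseteq> below_strict (ord \<rho>) b"
    if ab: "g a = Some s" "g b = Some s"
      and eq: "\<And>u v w. u \<in> below_strict (ord \<rho>) a \<Longrightarrow> v \<in> below_strict (ord \<rho>) b \<Longrightarrow>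
        g u = Some w \<Longrightarrow> g v = Some w \<Longrightarrow> u = v" for a b s
  proof
    fix u assume u: "u \<in> below_strict (ord \<rho>) a"
    then obtain w where w: "g u = Some w" "(w, s) \<in> ord \<rho>'" "w \<noteq> s"
      using tight_map_strict_mono[OF \<rho> \<rho>' t g ab(1)] by (auto simp: below_strict_def)
    then obtain v where v: "(v, b) \<in> ord \<rho>" "g v = Some w"
      using realisation_map_lift[OF g F ab(2)] by blast
    then have "v \<in> below_strict (ord \<rho>) b"
      using w ab by (auto simp: below_strict_def)
    then show "u \<in> below_strict (ord \<rho>) b"
      using eq[OF u _ w(1) v(2)] by simp
  qed
  from F car[OF assms(5)] have "\<forall>s r\<^sub>2. g r\<^sub>1 = Some s \<and> g r\<^sub>2 = Some s \<longrightarrow> r\<^sub>1 = r\<^sub>2"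
  proof (induction r\<^sub>1 rule: finitary_order_induct)
    case (less a)
    show ?case
    proof (intro allI impI, elim conjE)
      fix s b assume ab: "g a = Some s" "g b = Some s"
      have eq: "u = v" if "u \<in> below_strict (ord \<rho>) a" "g u = Some w" "g v = Some w" for u v w
        using less.IH[of u] that unfolding below_strict_def by blast
      have "below_strict (ord \<rho>) a = below_strict (ord \<rho>) b"
      proof
        show "below_strict (ord \<rho>) a \<subseteq> below_strict (ord \<rho>) b"
          by (rule half[OF ab]) (rule eq)
        show "below_strict (ord \<rho>) b \<subseteq> below_strict (ord \<rho>) a"
          by (rule half[OF ab(2,1)]) (rule eq[symmetric])
      qed
      moreover have "lab \<rho> a = lab \<rho> b"
        using g ab by (simp add: realisation_map_def)
      ultimately show "a = b"
        using tight_unique[OF t car[OF ab(1)] car[OF ab(2)]] by simp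
    qed
  qed
  then show ?thesis
    using assms by blast
qed

text \<open>Strict monotonicity makes the domain down-closed and the order preserved; lifting
  followed by injectivity makes the order reflected.\<close>

lemma tight_map_order_iso:
  assumes \<rho>: "is_realisation \<A> \<rho>" and \<rho>': "is_realisation \<A> \<rho>'" and t: "tight \<A> \<rho>"
    and g: "realisation_map \<rho> \<rho>' g"
  shows "down_closed (car \<rho>) (ord \<rho>) (dom g)"
    and "order_iso (restriction \<rho> (dom g)) \<rho>' (the \<circ> g)"
proof -
  note F = is_realisation_finitary[OF \<rho>] and F' = is_realisation_finitary[OF \<rho>']
  have mono: "\<exists>s'. g r' = Some s' \<and> (s', s) \<in> ord \<rho>'" if "g r = Some s" "(r', r) \<in> ord \<rho>" for r r' s
  proof (cases "r' = r")
    case True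
    have "s \<in> car \<rho>'"
      using g that(1) by (auto simp: realisation_map_def ran_def)
    then show ?thesis
      using True that finitary_orderD(2)[OF F'] by simp
  next
    case False
    then show ?thesis
      using tight_map_strict_mono[OF assms that] by blast
  qed
  moreover have "dom g \<subseteq> car \<rho>"
    using g by (simp add: realisation_map_def)
  ultimately show "down_closed (car \<rho>) (ord \<rho>) (dom g)"
    unfolding down_closed_def by blast
  have inj: "inj_on (the \<circ> g) (dom g)"
  proof (rule inj_onI)
    fix a b assume "a \<in> dom g" "b \<in> dom g" "(the \<circ> g) a = (the \<circ> g) b"
    then obtain s where "g a = Some s" "g b = Some s"
      by auto
    then show "a = b"
      by (rule tight_map_inj[OF assms])
  qed
  have im: "(the \<circ> g) ` dom g = car \<rho>'"
  proof -
    have "(the \<circ> g) ` dom g = ran g"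
      by (auto simp: ran_def image_iff dom_def) (metis option.sel)
    then show ?thesis
      using g by (simp add: realisation_map_def)
  qed
  have "(s\<^sub>1, s\<^sub>2) \<in> ord \<rho>' \<longleftrightarrow> (r\<^sub>1, r\<^sub>2) \<in> ord \<rho>" if rs: "g r\<^sub>1 = Some s\<^sub>1" "g r\<^sub>2 = Some s\<^sub>2" for r\<^sub>1 r\<^sub>2 s\<^sub>1 s\<^sub>2
  proof
    assume "(s\<^sub>1, s\<^sub>2) \<in> ord \<rho>'"
    then obtain r where "(r, r\<^sub>2) \<in> ord \<rho>" "g r = Some s\<^sub>1"
      using realisation_map_lift[OF g F rs(2)] by blast
    then show "(r\<^sub>1, r\<^sub>2) \<in> ord \<rho>"
      using tight_map_inj[OF assms rs(1)] by blast
  next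
    assume "(r\<^sub>1, r\<^sub>2) \<in> ord \<rho>"
    then show "(s\<^sub>1, s\<^sub>2) \<in> ord \<rho>'"
      using mono[OF rs(2)] rs(1) by fastforce
  qed
  moreover have "lab \<rho>' s = lab \<rho> r" if "g r = Some s" for r s
    using g that by (simp add: realisation_map_def)
  ultimately show "order_iso (restriction \<rho> (dom g)) \<rho>' (the \<circ> g)"
    using inj im by (auto simp: order_iso_def bij_betw_def)
qed

section \<open>Equivalence of tightness and extremality\<close>

lemma restriction_car: "ord \<rho> \<subseteq> car \<rho> \<times> car \<rho> \<Longrightarrow> restriction \<rho> (car \<rho>) = \<rho>"
  by (simp add: restriction_def Int_absorb2)

text \<open>For a total map the down-closed part on which it is an isomorphism is the whole
  realisation, and the inverse order isomorphism supplies the inverse map.\<close>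

lemma tight_imp_extremal:
  assumes \<rho>: "is_realisation \<A> \<rho>" and t: "tight \<A> \<rho>"
  shows "extremal \<A> \<rho>"
  unfolding extremal_def
proof (intro conjI \<rho> allI impI, elim conjE)
  fix \<rho>' :: "('b, 'a) realisation" and g
  assume \<rho>': "is_realisation \<A> \<rho>'" and g: "total_realisation_map \<rho> \<rho>' g"
  then have g': "realisation_map \<rho> \<rho>' g" "dom g = car \<rho>"
    by (auto simp: total_realisation_map_def)
  note O = finitary_orderD(1)[OF is_realisation_finitary]
  have iso: "order_iso \<rho> \<rho>' (the \<circ> g)"
    using tight_map_order_iso(2)[OF \<rho> \<rho>' t g'(1)] restriction_car[OF O[OF \<rho>]] g'(2) by simp
  let ?k = "inv_into (car \<rho>) (the \<circ> g)"
  have b: "bij_betw (the \<circ> g) (car \<rho>) (car \<rho>')"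
    using iso by (simp add: order_iso_def)
  have gS: "g e = Some (the (g e))" if "e \<in> car \<rho>" for e
    using that g'(2) by (metis domD option.sel)
  show "realisation_iso \<rho> \<rho>' g"
  proof (rule realisation_isoI[OF g'(1) order_iso_map[OF order_iso_inv[OF iso] O[OF \<rho>]]])
    show "(\<lambda>e. if e \<in> car \<rho>' then Some (?k e) else None) \<circ>\<^sub>m g = Some |` car \<rho>"
    proof
      fix e show "((\<lambda>e. if e \<in> car \<rho>' then Some (?k e) else None) \<circ>\<^sub>m g) e = (Some |` car \<rho>) e"
      proof (cases "e \<in> car \<rho>")
        case True
        then obtain b where gb: "g e = Some b"
          using gS by blast
        then have "b \<in> car \<rho>'" "?k b = e"
          using g'(1) bij_betw_inv_into_left[OF b True]
          by (auto simp: realisation_map_def ran_def)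
        then show ?thesis
          using True gb by simp
      next
        case False
        then have "g e = None"
          using g'(2) by (metis domIff)
        then show ?thesis
          using False by simp
      qed
    qed
    show "g \<circ>\<^sub>m (\<lambda>e. if e \<in> car \<rho>' then Some (?k e) else None) = Some |` car \<rho>'"
    proof
      fix e show "(g \<circ>\<^sub>m (\<lambda>e. if e \<in> car \<rho>' then Some (?k e) else None)) e = (Some |` car \<rho>') e"
      proof (cases "e \<in> car \<rho>'")
        case True
        then have "?k e \<in> car \<rho>" "the (g (?k e)) = e"
          using b bij_betw_inv_into_right[OF b True] by (auto simp: bij_betw_def inv_into_into)
        then have "g (?k e) = Some e"
          using gS[of "?k e"] by simp
        then show ?thesis
          using True by simp
      qed simp
    qed
  qed
qed

text \<open>The two consequences of extremality that refute a failure of tightness: the preimage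
  property serves the minimality clause, injectivity the uniqueness clause. The preimage of a
  down-closed set is its image under the inverse map.\<close>

lemma extremal_total_imp:
  assumes "extremal \<A> \<rho>" "is_realisation \<A> \<rho>'" "total_realisation_map \<rho> \<rho>' g"
  shows "inj_on g (car \<rho>)"
    and "\<And>x. down_closed (car \<rho>') (ord \<rho>') x \<Longrightarrow> down_closed (car \<rho>) (ord \<rho>) {e \<in> car \<rho>. \<exists>b\<in>x. g e = Some b}"
proof -
  have iso: "realisation_iso \<rho> \<rho>' g"
    using assms extremal_any_target by blast
  then show "inj_on g (car \<rho>)"
    by (simp add: realisation_iso_def)
  obtain g' where g: "realisation_map \<rho> \<rho>' g" "realisation_map \<rho>' \<rho> g'"
    "g' \<circ>\<^sub>m g = Some |` car \<rho>" "g \<circ>\<^sub>m g' = Some |` car \<rho>'"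
    using iso by (rule realisation_isoE)
  fix x assume x: "down_closed (car \<rho>') (ord \<rho>') x"
  have xc: "x \<subseteq> car \<rho>'" and rg: "ran g' = car \<rho>"
    using x g(2) by (simp_all add: down_closed_def realisation_map_def)
  have "pimage g' x = {e \<in> car \<rho>. \<exists>b\<in>x. g e = Some b}"
  proof (intro equalityI subsetI)
    fix e assume "e \<in> pimage g' x"
    then obtain b where b: "b \<in> x" "g' b = Some e"
      by (auto simp: pimage_def)
    then have "b \<in> car \<rho>'" "e \<in> car \<rho>"
      using xc ranI[of g' b e] by (auto simp: rg)
    then have "(g \<circ>\<^sub>m g') b = Some b"
      by (simp add: g(4))
    then show "e \<in> {e \<in> car \<rho>. \<exists>b\<in>x. g e = Some b}"
      using b \<open>e \<in> car \<rho>\<close> by auto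
  next
    fix e assume "e \<in> {e \<in> car \<rho>. \<exists>b\<in>x. g e = Some b}"
    then obtain b where b: "e \<in> car \<rho>" "b \<in> x" "g e = Some b"
      by auto
    then have "(g' \<circ>\<^sub>m g) e = Some e"
      by (simp add: g(3))
    then show "e \<in> pimage g' x"
      using b by (auto simp: pimage_def)
  qed
  then show "down_closed (car \<rho>) (ord \<rho>) {e \<in> car \<rho>. \<exists>b\<in>x. g e = Some b}"
    using g(2) x by (metis realisation_map_def)
qed

lemma extremal_imp_minimal:
  assumes \<A>: "configuration_family \<A>" and ex: "extremal \<A> \<rho>" and r: "r \<in> car \<rho>"
    and X: "down_closed (car \<rho>) (ord \<rho>) X" "X \<subseteq> below_strict (ord \<rho>) r"
      "insert (lab \<rho> r) (lab \<rho> ` X) \<in> \<A>"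
  shows "X = below_strict (ord \<rho>) r"
proof -
  have \<rho>: "is_realisation \<A> \<rho>"
    using ex by (simp add: extremal_def)
  note F = is_realisation_finitary[OF \<rho>]
  note D = finitary_orderD[OF F]
  \<comment> \<open>Weaken the order by keeping only \<open>X\<close> strictly below \<open>r\<close>.\<close>
  define le where "le = {(a, b) \<in> ord \<rho>. b = r \<longrightarrow> a \<in> insert r X}"
  have XD: "a \<in> X" if "b \<in> X" "(a, b) \<in> ord \<rho>" for a b
    using X(1) that by (auto simp: down_closed_def)
  have be: "below_eq le e = (if e = r then insert r X else below_eq (ord \<rho>) e)" if "e \<in> car \<rho>" for e
    using that X(2) D(2) by (auto simp: le_def below_eq_def below_strict_def)
  have F': "finitary_order (car \<rho>) le"
  proof (rule finitary_orderI)
    show "le \<subseteq> car \<rho> \<times> car \<rho>"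
      using D(1) by (auto simp: le_def)
    show "(a, a) \<in> le" if "a \<in> car \<rho>" for a
      using D(2) that by (auto simp: le_def)
    \<comment> \<open>Only the case \<open>c = r\<close> adds anything to the old transitivity.
      There \<open>b\<close> is \<open>r\<close> or lies in \<open>X\<close>, and in the latter case
      \<open>a\<close> lies in \<open>X\<close> because \<open>X\<close> is down-closed.\<close>
    show "(a, c) \<in> le" if "(a, b) \<in> le" "(b, c) \<in> le" for a b c
      using that D(3)[of a b c] XD[of b a] by (auto simp: le_def)
    show "a = b" if "(a, b) \<in> le" "(b, a) \<in> le" for a b
      using that D(4) by (auto simp: le_def)
    show "finite (below_eq le e)" if "e \<in> car \<rho>" for e
      by (rule finite_subset[OF _ D(7)[OF that]]) (auto simp: below_eq_def le_def)
  qed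
  let ?\<rho> = "\<lparr> car = car \<rho>, ord = le, lab = lab \<rho> \<rparr>"
  have "is_realisation \<A> ?\<rho>"
    using is_realisation_down_closed[OF \<rho> down_closed_below_eq[OF F]] X(3)
    by (intro is_realisationI[OF \<A>, where z = "lab \<rho> ` car \<rho>"])
      (auto simp: F' be is_realisation_car[OF \<rho>])
  moreover have "total_realisation_map \<rho> ?\<rho> (Some |` car \<rho>)"
    unfolding total_realisation_map_def
  proof (rule conjI, rule realisation_mapI)
    show "ran (Some |` car \<rho>) = car ?\<rho>"
      by (auto simp: ran_def restrict_map_def)
  next
    fix a s s' assume "(Some |` car \<rho>) a = Some s" "(s', s) \<in> ord ?\<rho>"
    then show "\<exists>a'. (a', a) \<in> ord \<rho> \<and> (Some |` car \<rho>) a' = Some s'"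
      using D(5) by (intro exI[of _ s']) (auto simp: le_def restrict_map_def split: if_splits)
  qed (auto simp: restrict_map_def split: if_splits)
  \<comment> \<open>As the identity onto the weakened realisation is an isomorphism, the new
    down-set of \<open>r\<close> is down-closed for the old order too. It is
    \<open>insert r X\<close>, so no event strictly below \<open>r\<close> can be missing from
    \<open>X\<close>.\<close>
  ultimately have "down_closed (car \<rho>) (ord \<rho>) {e \<in> car \<rho>. \<exists>b\<in>below_eq le r. (Some |` car \<rho>) e = Some b}"
    using extremal_total_imp(2)[OF ex, of ?\<rho> "Some |` car \<rho>" "below_eq le r"]
      down_closed_below_eq[OF F'] by simp
  moreover have "{e \<in> car \<rho>. \<exists>b\<in>below_eq le r. (Some |` car \<rho>) e = Some b} = insert r X"
    using be[OF r] r X(1) by (auto simp: down_closed_def)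
  ultimately show ?thesis
    using X(2) unfolding down_closed_def below_strict_def by auto
qed

text \<open>Equal strict down-sets make \<open>r\<close> and \<open>s\<close> incomparable when
  distinct. Merging them then keeps every principal down-set the image of an old one, with the same
  labels, so the quotient is a realisation reached by a total map that is not injective.\<close>

lemma extremal_imp_unique:
  assumes \<A>: "configuration_family \<A>" and ex: "extremal \<A> \<rho>" and rs: "r \<in> car \<rho>" "s \<in> car \<rho>"
    and eq: "below_strict (ord \<rho>) r = below_strict (ord \<rho>) s" "lab \<rho> r = lab \<rho> s"
  shows "r = s"
proof (rule ccontr)
  assume ne: "r \<noteq> s"
  have \<rho>: "is_realisation \<A> \<rho>"
    using ex by (simp add: extremal_def)
  note F = is_realisation_finitary[OF \<rho>]
  note D = finitary_orderD[OF F]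
  have rs_inc: "(s, r) \<notin> ord \<rho>" "(r, s) \<notin> ord \<rho>"
    using eq(1) ne by (auto simp: below_strict_def)
  have rs_iff: "(a, r) \<in> ord \<rho> \<longleftrightarrow> (a, s) \<in> ord \<rho>" if "a \<noteq> r" "a \<noteq> s" for a
    using eq(1) that by (auto simp: below_strict_def)
  \<comment> \<open>Identify \<open>s\<close> with \<open>r\<close>.\<close>
  define R where "R = car \<rho> - {s}"
  define g where "g e = (if e = s then r else e)" for e
  \<comment> \<open>The second disjunct puts \<open>r\<close> below everything that was above
    \<open>s\<close>. Nothing new comes below \<open>r\<close> itself, since the strict down-sets of
    \<open>r\<close> and \<open>s\<close> agree.\<close>
  define le where "le = {(a, b). a \<in> R \<and> b \<in> R \<and> ((a, b) \<in> ord \<rho> \<or> a = r \<and> (s, b) \<in> ord \<rho>)}"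
  have be: "below_eq le (g e) = g ` below_eq (ord \<rho>) e" if e: "e \<in> car \<rho>" for e
  proof (cases "e = s")
    case True
    have "below_eq le r = below_eq (ord \<rho>) r"
      using rs_inc rs(1) D(5) by (auto simp: below_eq_def le_def R_def ne)
    also have "\<dots> = g ` below_eq (ord \<rho>) s"
      using below_eq_insert[OF F rs(1)] below_eq_insert[OF F rs(2)] eq(1)
      by (auto simp: g_def below_strict_def image_iff)
    finally show ?thesis
      using True by (simp add: g_def)
  next
    case False
    then show ?thesis
      using e rs ne D(5) by (auto simp: below_eq_def le_def g_def R_def image_iff)
  qed
  have F': "finitary_order R le"
  proof (rule finitary_orderI)
    show "le \<subseteq> R \<times> R"
      by (auto simp: le_def)
    show "(a, a) \<in> le" if "a \<in> R" for a
      using D(2) that by (auto simp: le_def R_def)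
    show "(a, c) \<in> le" if "(a, b) \<in> le" "(b, c) \<in> le" for a b c
    proof -
      have "(a, b) \<in> ord \<rho> \<or> a = r \<and> (s, b) \<in> ord \<rho>" "(b, c) \<in> ord \<rho> \<or> b = r \<and> (s, c) \<in> ord \<rho>"
        and R: "a \<in> R" "b \<in> R" "c \<in> R"
        using that by (auto simp: le_def)
      then have "(a, c) \<in> ord \<rho> \<or> a = r \<and> (s, c) \<in> ord \<rho>"
        using D(3)[of a b c] D(3)[of s b c] D(3)[of a s c] rs_iff[of a] rs_inc by (auto simp: R_def)
      then show ?thesis
        using R by (simp add: le_def)
    qed
    show "a = b" if "(a, b) \<in> le" "(b, a) \<in> le" for a b
      using that D(4)[of a b] D(3)[of s a b] D(3)[of s b a] rs_inc by (auto simp: le_def)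
    show "finite (below_eq le e)" if "e \<in> R" for e
      using be[of e] D(7)[of e] that by (auto simp: R_def g_def)
  qed
  let ?\<rho> = "\<lparr> car = R, ord = le, lab = lab \<rho> \<rparr>"
  let ?g = "\<lambda>e. if e \<in> car \<rho> then Some (g e) else None"
  have lab: "lab \<rho> (g e) = lab \<rho> e" for e
    using eq(2) by (simp add: g_def)
  have "lab \<rho> ` below_eq le e \<in> \<A>" if "e \<in> R" for e
  proof -
    have "lab \<rho> ` below_eq le e = lab \<rho> ` below_eq (ord \<rho>) e"
      using be[of e] that by (simp add: R_def g_def[of e] image_image lab)
    then show ?thesis
      using is_realisation_down_closed[OF \<rho> down_closed_below_eq[OF F]] by simp
  qed
  then have "is_realisation \<A> ?\<rho>"
    by (intro is_realisationI[OF \<A>, where z = "lab \<rho> ` car \<rho>"])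
      (use F' in \<open>auto simp: R_def is_realisation_car[OF \<rho>]\<close>)
  moreover have "total_realisation_map \<rho> ?\<rho> ?g"
    unfolding total_realisation_map_def
  proof (rule conjI, rule realisation_mapI)
    show "ran ?g = car ?\<rho>"
      using rs ne by (auto simp: ran_def R_def g_def)
  next
    fix a b b' assume ab: "?g a = Some b" "(b', b) \<in> ord ?\<rho>"
    then have "a \<in> car \<rho>" "b = g a"
      by (auto split: if_splits)
    then have "b' \<in> g ` below_eq (ord \<rho>) a"
      using ab(2) be[of a] by (auto simp: below_eq_def)
    then show "\<exists>a'. (a', a) \<in> ord \<rho> \<and> ?g a' = Some b'"
      using D(5) by (auto simp: below_eq_def)
  qed (auto simp: lab split: if_splits)
  ultimately have "inj_on ?g (car \<rho>)"
    by (rule extremal_total_imp(1)[OF ex])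
  moreover have "?g r = ?g s"
    using rs by (simp add: g_def)
  ultimately show False
    using inj_onD[OF _ _ rs] ne by blast
qed

lemma extremal_iff_tight:
  assumes "configuration_family \<A>"
  shows "extremal \<A> \<rho> \<longleftrightarrow> is_realisation \<A> \<rho> \<and> tight \<A> \<rho>"
proof
  assume ex: "extremal \<A> \<rho>"
  have "tight \<A> \<rho>"
    unfolding tight_def
    using extremal_imp_minimal[OF assms ex] extremal_imp_unique[OF assms ex] by blast
  then show "is_realisation \<A> \<rho> \<and> tight \<A> \<rho>"
    using ex by (simp add: extremal_def)
qed (use tight_imp_extremal in blast)

subsection \<open>Principal parts\<close>

text \<open>By induction \<open>\<phi>\<close> fixes everything strictly below \<open>r\<close>, so
  \<open>\<phi> r\<close> and \<open>r\<close> have the same strict down-set and the same label. In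
  particular, isomorphic down-closed parts are equal as sets.\<close>

lemma order_iso_rigid:
  assumes F: "finitary_order (car \<rho>) (ord \<rho>)" and t: "tight \<A> \<rho>"
    and x: "down_closed (car \<rho>) (ord \<rho>) x" and y: "down_closed (car \<rho>) (ord \<rho>) y"
    and \<phi>: "order_iso (restriction \<rho> x) (restriction \<rho> y) \<phi>" and "r \<in> x"
  shows "\<phi> r = r"
proof -
  have xy: "x \<subseteq> car \<rho>" "y \<subseteq> car \<rho>"
    using x y by (auto simp: down_closed_def)
  have b: "bij_betw \<phi> x y"
    using \<phi> by (simp add: order_iso_def)
  have im: "\<phi> a \<in> y" if "a \<in> x" for a
    using b that by (auto simp: bij_betw_def)
  have iff: "(\<phi> a, \<phi> b) \<in> ord \<rho> \<longleftrightarrow> (a, b) \<in> ord \<rho>" if "a \<in> x" "b \<in> x" for a b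
    using \<phi> that im by (auto simp: order_iso_def)
  have inj: "\<phi> a = \<phi> b \<longleftrightarrow> a = b" if "a \<in> x" "b \<in> x" for a b
    using b that by (auto simp: bij_betw_def inj_on_eq_iff)
  have "r \<in> car \<rho>"
    using xy \<open>r \<in> x\<close> by auto
  with F have "r \<in> x \<longrightarrow> \<phi> r = r"
  proof (induction r rule: finitary_order_induct)
    case (less r)
    show ?case
    proof
      assume r: "r \<in> x"
      have IH: "v \<in> x" "\<phi> v = v" if "(v, r) \<in> ord \<rho>" "v \<noteq> r" for v
        using less.IH[OF that] that r x by (auto simp: down_closed_def)
      have "below_strict (ord \<rho>) (\<phi> r) = below_strict (ord \<rho>) r"
      proof (intro equalityI subsetI)
        fix u assume u: "u \<in> below_strict (ord \<rho>) (\<phi> r)"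
        then have "u \<in> y"
          using im[OF r] y by (auto simp: below_strict_def down_closed_def)
        then obtain v where v: "v \<in> x" "u = \<phi> v"
          using b by (auto simp: bij_betw_def)
        then have "(v, r) \<in> ord \<rho>" "v \<noteq> r"
          using u iff r by (auto simp: below_strict_def)
        then show "u \<in> below_strict (ord \<rho>) r"
          using IH(2) v by (simp add: below_strict_def)
      next
        fix v assume "v \<in> below_strict (ord \<rho>) r"
        then have v: "(v, r) \<in> ord \<rho>" "v \<noteq> r"
          by (auto simp: below_strict_def)
        then show "v \<in> below_strict (ord \<rho>) (\<phi> r)"
          using IH[OF v] iff[of v r] inj[of v r] r by (simp add: below_strict_def)
      qed
      moreover have "lab \<rho> (\<phi> r) = lab \<rho> r"
        using \<phi> r by (simp add: order_iso_def)
      moreover have "\<phi> r \<in> car \<rho>"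
        using im[OF r] xy by auto
      ultimately show "\<phi> r = r"
        using tight_unique[OF t] less.hyps by blast
    qed
  qed
  then show ?thesis
    using \<open>r \<in> x\<close> by blast
qed

definition principal_part :: "('r, 'a) realisation \<Rightarrow> 'r \<Rightarrow> ('r, 'a) realisation" where
  "principal_part \<rho> r = restriction \<rho> (below_eq (ord \<rho>) r)"

lemma is_realisation_principal:
  "is_realisation \<A> \<rho> \<Longrightarrow> is_realisation \<A> (principal_part \<rho> r)"
  unfolding principal_part_def
  by (simp add: is_realisation_restriction down_closed_below_eq is_realisation_finitary)

lemma tight_principal:
  "is_realisation \<A> \<rho> \<Longrightarrow> tight \<A> \<rho> \<Longrightarrow> tight \<A> (principal_part \<rho> r)"
  unfolding principal_part_def
  by (simp add: tight_restriction down_closed_below_eq is_realisation_finitary)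

lemma is_greatest_principal:
  assumes "finitary_order (car \<rho>) (ord \<rho>)" "r \<in> car \<rho>"
  shows "is_greatest (principal_part \<rho> r) r"
  using finitary_orderD(2)[OF assms] by (auto simp: is_greatest_def principal_part_def below_eq_def)

lemma prime_extremal_principal:
  assumes "configuration_family \<A>" "extremal \<A> \<rho>" "r \<in> car \<rho>"
  shows "prime_extremal \<A> (principal_part \<rho> r)"
  using assms is_realisation_principal[of \<A> \<rho> r] tight_principal[of \<A> \<rho> r]
    is_greatest_principal[OF is_realisation_finitary[of \<A> \<rho>] assms(3)]
  by (auto simp: prime_extremal_def extremal_iff_tight)

lemma principal_greatest:
  assumes "finitary_order (car \<rho>) (ord \<rho>)" "is_greatest \<rho> t"
  shows "principal_part \<rho> t = \<rho>"
proof -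
  have "below_eq (ord \<rho>) t = car \<rho>"
    using assms finitary_orderD(5)[OF assms(1)] by (auto simp: below_eq_def is_greatest_def)
  then show ?thesis
    using finitary_orderD(1)[OF assms(1)] by (simp add: principal_part_def restriction_car)
qed

lemma principal_principal:
  assumes "finitary_order (car \<rho>) (ord \<rho>)" "(s, r) \<in> ord \<rho>"
  shows "principal_part (principal_part \<rho> r) s = principal_part \<rho> s"
proof -
  have "below_eq (ord \<rho>) s \<subseteq> below_eq (ord \<rho>) r"
    using finitary_orderD(3)[OF assms(1)] assms(2) by (auto simp: below_eq_def)
  moreover from this have "below_eq (ord \<rho> \<inter> below_eq (ord \<rho>) r \<times> below_eq (ord \<rho>) r) s = below_eq (ord \<rho>) s"
    using assms(2) by (auto simp: below_eq_def)
  ultimately show ?thesis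
    by (auto simp: principal_part_def restriction_def)
qed

text \<open>The domain of a map onto \<open>\<rho>'\<close> is a down-closed copy of
  \<open>\<rho>'\<close>; the preimage of \<open>t\<close> is greatest in it, so the domain is the
  principal down-set of that preimage.\<close>

lemma below_imp_principal:
  assumes \<rho>: "is_realisation \<A> \<rho>" and t: "tight \<A> \<rho>" and \<rho>': "is_realisation \<A> \<rho>'"
    and top: "is_greatest \<rho>' t" and "\<rho>' \<preceq> \<rho>"
  shows "\<exists>r\<in>car \<rho>. isomorphic (principal_part \<rho> r) \<rho>'"
proof -
  obtain g where g: "realisation_map \<rho> \<rho>' g"
    using \<open>\<rho>' \<preceq> \<rho>\<close> by (auto simp: below_def)
  note iso = tight_map_order_iso[OF \<rho> \<rho>' t g]
  have "t \<in> ran g"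
    using g top by (simp add: realisation_map_def is_greatest_def)
  then obtain r where r: "g r = Some t"
    by (auto simp: ran_def)
  then have rc: "r \<in> car \<rho>"
    using g by (auto simp: realisation_map_def)
  have "dom g = below_eq (ord \<rho>) r"
  proof (intro equalityI subsetI)
    fix a assume "a \<in> dom g"
    then obtain s where s: "g a = Some s"
      by auto
    then have "s \<in> car \<rho>'"
      using g by (auto simp: realisation_map_def ran_def)
    then have "(s, t) \<in> ord \<rho>'"
      using top by (simp add: is_greatest_def)
    then have "(a, r) \<in> ord \<rho>"
      using iso(2) r s by (force simp: order_iso_def)
    then show "a \<in> below_eq (ord \<rho>) r"
      by (simp add: below_eq_def)
  next
    fix a assume "a \<in> below_eq (ord \<rho>) r"
    then show "a \<in> dom g"
      using iso(1) r unfolding down_closed_def below_eq_def by blast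
  qed
  then have "order_iso (principal_part \<rho> r) \<rho>' (the \<circ> g)"
    using iso(2) by (simp add: principal_part_def)
  then have "isomorphic (principal_part \<rho> r) \<rho>'"
    using finitary_orderD(1)[OF is_realisation_finitary[OF is_realisation_principal[OF \<rho>]]]
      finitary_orderD(1)[OF is_realisation_finitary[OF \<rho>']]
    by (rule order_iso_isomorphic)
  then show ?thesis
    using rc by blast
qed

text \<open>By rigidity the isomorphism is the identity, so the two principal down-sets coincide and
  antisymmetry applies.\<close>

lemma isomorphic_principal_eq:
  assumes \<rho>: "is_realisation \<A> \<rho>" and t: "tight \<A> \<rho>" and rs: "r \<in> car \<rho>" "s \<in> car \<rho>"
    and "isomorphic (principal_part \<rho> r) (principal_part \<rho> s)"
  shows "r = s"
proof -
  note F = is_realisation_finitary[OF \<rho>]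
  note Fp = is_realisation_finitary[OF is_realisation_principal[OF \<rho>]]
  obtain \<phi> where \<phi>: "order_iso (principal_part \<rho> r) (principal_part \<rho> s) \<phi>"
    using isomorphic_order_iso[OF assms(5) Fp Fp] by blast
  have "\<phi> a = a" if "a \<in> below_eq (ord \<rho>) r" for a
    using order_iso_rigid[OF F t down_closed_below_eq[OF F] down_closed_below_eq[OF F]] \<phi> that
    unfolding principal_part_def by blast
  then have "\<phi> ` below_eq (ord \<rho>) r = below_eq (ord \<rho>) r"
    by force
  moreover have "\<phi> ` below_eq (ord \<rho>) r = below_eq (ord \<rho>) s"
    using \<phi> by (simp add: order_iso_def principal_part_def bij_betw_def)
  ultimately have "below_eq (ord \<rho>) r = below_eq (ord \<rho>) s"
    by simp
  then have "(r, s) \<in> ord \<rho>" "(s, r) \<in> ord \<rho>"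
    using finitary_orderD(2)[OF F] rs unfolding below_eq_def by blast+
  then show ?thesis
    by (rule finitary_orderD(4)[OF F])
qed

text \<open>The order of a tight realisation is recovered from \<open>\<preceq>\<close> on its
  principal parts. From left to right, a copy of the part of \<open>r\<close> sits inside the part
  of \<open>s\<close> as the part of some \<open>u\<close> below \<open>s\<close>, and rigidity
  forces \<open>u = r\<close>.\<close>

lemma principal_below_iff:
  assumes \<rho>: "is_realisation \<A> \<rho>" and t: "tight \<A> \<rho>" and rs: "r \<in> car \<rho>" "s \<in> car \<rho>"
  shows "principal_part \<rho> r \<preceq> principal_part \<rho> s \<longleftrightarrow> (r, s) \<in> ord \<rho>"
proof
  note F = is_realisation_finitary[OF \<rho>]
  assume "principal_part \<rho> r \<preceq> principal_part \<rho> s"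
  then obtain u where u: "u \<in> car (principal_part \<rho> s)" "isomorphic (principal_part (principal_part \<rho> s) u) (principal_part \<rho> r)"
    using below_imp_principal[OF is_realisation_principal[OF \<rho>] tight_principal[OF \<rho> t]
        is_realisation_principal[OF \<rho>] is_greatest_principal[OF F rs(1)]] by blast
  then have us: "(u, s) \<in> ord \<rho>"
    by (simp add: principal_part_def below_eq_def)
  then have "isomorphic (principal_part \<rho> u) (principal_part \<rho> r)"
    using u(2) by (simp add: principal_principal[OF F])
  then have "u = r"
    using isomorphic_principal_eq[OF \<rho> t finitary_orderD(5)[OF F us] rs(1)] by simp
  then show "(r, s) \<in> ord \<rho>"
    using us by simp
next
  note F = is_realisation_finitary[OF \<rho>]
  assume "(r, s) \<in> ord \<rho>"
  then have "below_eq (ord \<rho>) r \<subseteq> below_eq (ord \<rho>) s"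
    using finitary_orderD(3)[OF F] by (auto simp: below_eq_def)
  then show "principal_part \<rho> r \<preceq> principal_part \<rho> s"
    unfolding principal_part_def by (rule restriction_below[OF down_closed_below_eq[OF F]])
qed

section \<open>Labels of greatest elements under isomorphism\<close>

lemma rmax_eq:
  assumes "finitary_order (car \<rho>) (ord \<rho>)" "is_greatest \<rho> t"
  shows "rmax \<rho> = lab \<rho> t"
proof -
  have "(THE t. is_greatest \<rho> t) = t"
    using assms(2) finitary_orderD(4)[OF assms(1)]
    by (intro the_equality) (auto simp: is_greatest_def)
  then show ?thesis
    by (simp add: rmax_def)
qed

lemma order_iso_greatest:
  assumes "order_iso \<rho> \<rho>' \<phi>" "is_greatest \<rho> t"
  shows "is_greatest \<rho>' (\<phi> t)"
proof -
  have "car \<rho>' = \<phi> ` car \<rho>"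
    using assms(1) by (simp add: order_iso_def bij_betw_def)
  then show ?thesis
    using assms by (auto simp: is_greatest_def order_iso_def)
qed

lemma rmax_isomorphic:
  assumes "isomorphic \<rho> \<rho>'" "finitary_order (car \<rho>) (ord \<rho>)" "finitary_order (car \<rho>') (ord \<rho>')"
    and "is_greatest \<rho> t"
  shows "rmax \<rho>' = lab \<rho> t"
proof -
  obtain \<phi> where \<phi>: "order_iso \<rho> \<rho>' \<phi>"
    using isomorphic_order_iso[OF assms(1-3)] by blast
  then have "rmax \<rho>' = lab \<rho>' (\<phi> t)"
    using rmax_eq[OF assms(3)] order_iso_greatest[OF \<phi> assms(4)] by blast
  then show ?thesis
    using \<phi> assms(4) by (simp add: order_iso_def is_greatest_def)
qed

subsection \<open>The order of prime extremal realisations\<close>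

text \<open>Arranged as a record of type \<open>realisation\<close> so that tightness, restrictions
  and principal parts apply to \<open>P\<close>. Its elements are themselves realisations, so its
  carrier type differs from that of its elements.\<close>

definition er_order :: "('r, 'a) realisation set \<Rightarrow> (('r, 'a) realisation, 'a) realisation" where
  "er_order P = \<lparr> car = P, ord = er_le P, lab = rmax \<rparr>"

lemma er_order_simps [simp]:
  "car (er_order P) = P" "ord (er_order P) = er_le P" "lab (er_order P) = rmax"
  by (simp_all add: er_order_def)

locale representatives =
  fixes \<A> :: "'a set set" and P :: "('r::infinite, 'a) realisation set"
  assumes fam: "configuration_family \<A>" and choice: "is_choice_of_representatives \<A> P"
begin

lemma prime_extremal_mem: "p \<in> P \<Longrightarrow> prime_extremal \<A> p"
  using choice by (simp add: is_choice_of_representatives_def)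

lemma extremal_mem: "p \<in> P \<Longrightarrow> extremal \<A> p"
  using prime_extremal_mem by (simp add: prime_extremal_def)

lemma realisation_mem: "p \<in> P \<Longrightarrow> is_realisation \<A> p"
  using extremal_mem by (simp add: extremal_def)

lemma tight_mem: "p \<in> P \<Longrightarrow> tight \<A> p"
  using extremal_mem fam by (simp add: extremal_iff_tight)

lemma finitary_mem: "p \<in> P \<Longrightarrow> finitary_order (car p) (ord p)"
  using realisation_mem by (rule is_realisation_finitary)

lemma isomorphic_mem_eq:
  assumes "p \<in> P" "q \<in> P" "isomorphic p q"
  shows "p = q"
proof -
  have "\<exists>!q. q \<in> P \<and> isomorphic p q"
    using choice prime_extremal_mem[OF assms(1)] by (simp add: is_choice_of_representatives_def)
  moreover have "isomorphic p p"
    by (rule isomorphic_refl[OF finitary_orderD(1)[OF finitary_mem[OF assms(1)]]])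
  ultimately show ?thesis
    using assms by blast
qed

text \<open>The carrier type is left free because the prime constructed over a subset of
  \<open>P\<close> has its carrier in an option type over realisations.\<close>

lemma ex_representative:
  fixes \<rho> :: "('s, 'a) realisation"
  assumes "prime_extremal \<A> \<rho>"
  shows "\<exists>p\<in>P. isomorphic \<rho> p"
proof -
  obtain \<rho>' :: "('r, 'a) realisation" where "prime_extremal \<A> \<rho>'" "isomorphic \<rho> \<rho>'"
    using prime_extremal_any_type[OF assms] by blast
  moreover from this obtain p where "p \<in> P" "isomorphic \<rho>' p"
    using choice by (auto simp: is_choice_of_representatives_def)
  ultimately show ?thesis
    using isomorphic_trans by blast
qed

text \<open>The event \<open>r\<close> of \<open>p\<close> corresponds to the history that ends in
  \<open>r\<close>; \<open>embed\<close> names the representative of that history. It is meaningful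
  only for \<open>p\<close> in \<open>P\<close> and \<open>r\<close> in its carrier.\<close>

definition embed :: "('r, 'a) realisation \<Rightarrow> 'r \<Rightarrow> ('r, 'a) realisation" where
  "embed p r = (SOME q. q \<in> P \<and> isomorphic (principal_part p r) q)"

lemma embed:
  assumes "p \<in> P" "r \<in> car p"
  shows "embed p r \<in> P" "isomorphic (principal_part p r) (embed p r)"
proof -
  have "\<exists>q. q \<in> P \<and> isomorphic (principal_part p r) q"
    using ex_representative[OF prime_extremal_principal[OF fam extremal_mem[OF assms(1)] assms(2)]]
    by blast
  then have "embed p r \<in> P \<and> isomorphic (principal_part p r) (embed p r)"
    unfolding embed_def by (rule someI_ex)
  then show "embed p r \<in> P" "isomorphic (principal_part p r) (embed p r)"
    by blast+
qed

lemma rmax_embed: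
  assumes "p \<in> P" "r \<in> car p"
  shows "rmax (embed p r) = lab p r"
proof -
  have "rmax (embed p r) = lab (principal_part p r) r"
    by (rule rmax_isomorphic[OF embed(2)[OF assms]
          is_realisation_finitary[OF is_realisation_principal[OF realisation_mem[OF assms(1)]]]
          finitary_mem[OF embed(1)[OF assms]]
          is_greatest_principal[OF finitary_mem[OF assms(1)] assms(2)]])
  then show ?thesis
    by (simp add: principal_part_def)
qed

lemma embed_le_iff:
  assumes p: "p \<in> P" and rs: "r \<in> car p" "s \<in> car p"
  shows "(embed p r, embed p s) \<in> er_le P \<longleftrightarrow> (r, s) \<in> ord p"
proof -
  have "(embed p r, embed p s) \<in> er_le P \<longleftrightarrow> embed p r \<preceq> embed p s"
    using embed(1)[OF p] rs by (simp add: er_le_def)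
  also have "\<dots> \<longleftrightarrow> principal_part p r \<preceq> principal_part p s"
    using isomorphic_below[OF embed(2)[OF p rs(1)]] isomorphic_below[OF embed(2)[OF p rs(2)]]
      isomorphic_below[OF isomorphic_sym[OF embed(2)[OF p rs(1)]]]
      isomorphic_below[OF isomorphic_sym[OF embed(2)[OF p rs(2)]]] below_trans by blast
  also have "\<dots> \<longleftrightarrow> (r, s) \<in> ord p"
    by (rule principal_below_iff[OF realisation_mem[OF p] tight_mem[OF p] rs])
  finally show ?thesis .
qed

lemma ex_greatest_mem:
  assumes "p \<in> P"
  obtains t where "is_greatest p t" "t \<in> car p" "embed p t = p" "rmax p = lab p t"
proof -
  obtain t where t: "is_greatest p t"
    using prime_extremal_mem[OF assms] by (auto simp: prime_extremal_def)
  then have tc: "t \<in> car p"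
    by (simp add: is_greatest_def)
  then have "isomorphic p (embed p t)"
    using embed(2)[OF assms tc] principal_greatest[OF finitary_mem[OF assms] t] by simp
  then have "embed p t = p"
    using isomorphic_mem_eq[OF assms embed(1)[OF assms tc]] by simp
  then show ?thesis
    using that[OF t tc] rmax_eq[OF finitary_mem[OF assms] t] by simp
qed

text \<open>One inclusion holds because \<open>p\<close> is the image of its own greatest event. For
  the other, anything \<open>\<preceq> p\<close> is isomorphic to a principal part of
  \<open>p\<close>, hence is the chosen representative of that part.\<close>

lemma embed_image:
  assumes p: "p \<in> P"
  shows "embed p ` car p = below_eq (er_le P) p"
proof (intro equalityI subsetI)
  obtain t where t: "is_greatest p t" "t \<in> car p" "embed p t = p"
    using ex_greatest_mem[OF p] by blast
  fix q assume "q \<in> embed p ` car p"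
  then obtain r where r: "r \<in> car p" "q = embed p r"
    by blast
  then have "(r, t) \<in> ord p"
    using t by (simp add: is_greatest_def)
  then show "q \<in> below_eq (er_le P) p"
    using embed_le_iff[OF p r(1) t(2)] t(3) r(2) by (simp add: below_eq_def)
next
  fix q assume "q \<in> below_eq (er_le P) p"
  then have q: "q \<in> P" "q \<preceq> p"
    by (auto simp: below_eq_def er_le_def)
  obtain u where u: "is_greatest q u"
    using ex_greatest_mem[OF q(1)] by blast
  obtain r where r: "r \<in> car p" "isomorphic (principal_part p r) q"
    using below_imp_principal[OF realisation_mem[OF p] tight_mem[OF p] realisation_mem[OF q(1)] u q(2)]
    by blast
  then have "isomorphic q (embed p r)"
    using isomorphic_trans[OF isomorphic_sym embed(2)[OF p]] by blast
  then have "q = embed p r"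
    using isomorphic_mem_eq[OF q(1) embed(1)[OF p r(1)]] by simp
  then show "q \<in> embed p ` car p"
    using r(1) by blast
qed

lemma er_le_finitary: "finitary_order P (er_le P)"
proof (rule finitary_orderI)
  show "er_le P \<subseteq> P \<times> P"
    by (auto simp: er_le_def)
  show "(p, p) \<in> er_le P" if "p \<in> P" for p
    using that isomorphic_below[OF isomorphic_refl[OF finitary_orderD(1)[OF finitary_mem[OF that]]]]
    by (simp add: er_le_def)
  show "(a, c) \<in> er_le P" if "(a, b) \<in> er_le P" "(b, c) \<in> er_le P" for a b c
    using that below_trans by (auto simp: er_le_def)
  \<comment> \<open>Mutual maps are not isomorphisms outright, so antisymmetry is read off inside
    \<open>p\<close>: \<open>p\<close> is the image of the greatest event \<open>t\<close>, and
    \<open>q\<close> is the image of some \<open>r\<close> with both \<open>t\<close> below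
    \<open>r\<close> and \<open>r\<close> below \<open>t\<close>.\<close>
  show "p = q" if pq: "(p, q) \<in> er_le P" "(q, p) \<in> er_le P" for p q
  proof -
    have p: "p \<in> P"
      using pq by (simp add: er_le_def)
    obtain t where t: "is_greatest p t" "t \<in> car p" "embed p t = p"
      using ex_greatest_mem[OF p] by blast
    obtain r where r: "r \<in> car p" "q = embed p r"
      using embed_image[OF p] pq(2) by (auto simp: below_eq_def)
    have "(t, r) \<in> ord p"
      using embed_le_iff[OF p t(2) r(1)] pq(1) t(3) r(2) by simp
    moreover have "(r, t) \<in> ord p"
      using t(1) r(1) by (simp add: is_greatest_def)
    ultimately have "t = r"
      by (rule finitary_orderD(4)[OF finitary_mem[OF p]])
    then show ?thesis
      using t(3) r(2) by simp
  qed
  show "finite (below_eq (er_le P) p)" if p: "p \<in> P" for p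
  proof -
    obtain t where t: "is_greatest p t" "t \<in> car p"
      using ex_greatest_mem[OF p] by blast
    have "car p \<subseteq> below_eq (ord p) t"
      using t(1) by (auto simp: is_greatest_def below_eq_def)
    then have "finite (car p)"
      using finitary_orderD(7)[OF finitary_mem[OF p] t(2)] by (rule finite_subset)
    then show ?thesis
      using embed_image[OF p, symmetric] by simp
  qed
qed

lemma order_iso_embed:
  assumes p: "p \<in> P"
  shows "order_iso p (principal_part (er_order P) p) (embed p)"
proof -
  have "inj_on (embed p) (car p)"
  proof (rule inj_onI)
    fix r s assume rs: "r \<in> car p" "s \<in> car p" "embed p r = embed p s"
    have "(r, s) \<in> ord p" "(s, r) \<in> ord p"
      using embed_le_iff[OF p rs(1,1)] embed_le_iff[OF p rs(1,2)] embed_le_iff[OF p rs(2,1)] rs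
        finitary_orderD(2)[OF finitary_mem[OF p]] by auto
    then show "r = s"
      by (rule finitary_orderD(4)[OF finitary_mem[OF p]])
  qed
  then show ?thesis
    using embed_image[OF p] embed_le_iff[OF p] rmax_embed[OF p]
    by (auto simp: order_iso_def principal_part_def bij_betw_def)
qed

lemma rmax_below_eq:
  assumes "p \<in> P"
  shows "rmax ` below_eq (er_le P) p \<in> \<A>"
proof -
  have "rmax ` below_eq (er_le P) p = lab p ` car p"
    using embed_image[OF assms, symmetric] rmax_embed[OF assms] by (simp add: image_image)
  then show ?thesis
    using is_realisation_car[OF realisation_mem[OF assms]] by simp
qed

lemma rmax_down_closed:
  assumes "down_closed P (er_le P) X" "z \<in> \<A>" "rmax ` X \<subseteq> z"
  shows "rmax ` X \<in> \<A>"
proof (rule image_down_closed_mem[OF fam er_le_finitary assms(1) _ assms(2,3)])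
  fix p assume "p \<in> X"
  then show "rmax ` below_eq (er_le P) p \<in> \<A>"
    using assms(1) rmax_below_eq by (auto simp: down_closed_def)
qed

section \<open>Tightness of the order on \<open>P\<close> and existence of primes\<close>

lemma isomorphic_principal_er_order:
  assumes p: "p \<in> P"
  shows "isomorphic p (principal_part (er_order P) p)"
  by (rule order_iso_isomorphic[OF order_iso_embed[OF p] finitary_orderD(1)[OF finitary_mem[OF p]]])
    (auto simp: principal_part_def)

text \<open>Minimality is pulled back along \<open>embed p\<close> to the greatest event of
  \<open>p\<close>, where \<open>p\<close> itself is tight. For uniqueness, sending \<open>p\<close>
  to \<open>q\<close> and fixing everything below is an isomorphism of principal parts, so
  \<open>p\<close> and \<open>q\<close> are isomorphic, hence the same representative.\<close>

lemma tight_er_order: "tight \<A> (er_order P)"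
  unfolding tight_def
proof (intro conjI ballI allI impI; elim conjE)
  fix p X
  assume "p \<in> car (er_order P)" "down_closed (car (er_order P)) (ord (er_order P)) X"
    "X \<subseteq> below_strict (ord (er_order P)) p"
    "insert (lab (er_order P) p) (lab (er_order P) ` X) \<in> \<A>"
  then have p: "p \<in> P" and X: "down_closed P (er_le P) X" "X \<subseteq> below_strict (er_le P) p"
    "insert (rmax p) (rmax ` X) \<in> \<A>"
    by auto
  obtain t where t: "is_greatest p t" "t \<in> car p" "embed p t = p" "rmax p = lab p t"
    using ex_greatest_mem[OF p] by blast
  define Y where "Y = {r \<in> car p. embed p r \<in> X}"
  have "X \<subseteq> embed p ` car p"
    using X(2) by (auto simp: embed_image[OF p] below_eq_def below_strict_def)
  then have XY: "X = embed p ` Y"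
    by (auto simp: Y_def)
  have "down_closed (car p) (ord p) Y"
    unfolding down_closed_def
  proof (intro conjI ballI allI impI)
    fix r s assume r: "r \<in> Y" and sr: "(s, r) \<in> ord p"
    then have rs: "r \<in> car p" "s \<in> car p" "embed p r \<in> X"
      using finitary_orderD(5)[OF finitary_mem[OF p]] by (auto simp: Y_def)
    then have "(embed p s, embed p r) \<in> er_le P"
      using embed_le_iff[OF p] sr by simp
    then show "s \<in> Y"
      using rs X(1) by (auto simp: Y_def down_closed_def)
  qed (auto simp: Y_def)
  moreover have "Y \<subseteq> below_strict (ord p) t"
    using t X(2) by (auto simp: Y_def below_strict_def is_greatest_def)
  moreover have "insert (lab p t) (lab p ` Y) \<in> \<A>"
  proof -
    have "rmax ` X = lab p ` Y"
      unfolding XY image_image using rmax_embed[OF p] by (auto simp: Y_def intro!: image_cong)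
    then show ?thesis
      using X(3) t(4) by simp
  qed
  ultimately have Y: "Y = below_strict (ord p) t"
    by (rule tight_minimal[OF tight_mem[OF p] t(2)])
  have "below_strict (er_le P) p \<subseteq> X"
  proof
    fix q assume q: "q \<in> below_strict (er_le P) p"
    then obtain r where r: "r \<in> car p" "q = embed p r"
      using embed_image[OF p] by (auto simp: below_eq_def below_strict_def)
    then have "r \<in> Y"
      using q t by (auto simp: Y below_strict_def is_greatest_def)
    then show "q \<in> X"
      using XY r(2) by blast
  qed
  then show "X = below_strict (ord (er_order P)) p"
    using X(2) by auto
next
  fix p q
  assume "p \<in> car (er_order P)" "q \<in> car (er_order P)"
    "below_strict (ord (er_order P)) p = below_strict (ord (er_order P)) q"
    "lab (er_order P) p = lab (er_order P) q"
  then have pq: "p \<in> P" "q \<in> P" "below_strict (er_le P) p = below_strict (er_le P) q" "rmax p = rmax q"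
    by auto
  define \<phi> where "\<phi> u = (if u = p then q else u)" for u
  have lp: "below_eq (er_le P) p = insert p (below_strict (er_le P) p)"
    and lq: "below_eq (er_le P) q = insert q (below_strict (er_le P) p)"
    using below_eq_insert[OF er_le_finitary] pq by auto
  have np: "p \<notin> below_strict (er_le P) p" "q \<notin> below_strict (er_le P) p"
    using pq(3) by (auto simp: below_strict_def)
  have "bij_betw \<phi> (below_eq (er_le P) p) (below_eq (er_le P) q)"
    unfolding lp lq using np by (auto simp: bij_betw_def inj_on_def \<phi>_def)
  moreover have "(\<phi> a, \<phi> b) \<in> er_le P \<longleftrightarrow> (a, b) \<in> er_le P"
    if "a \<in> below_eq (er_le P) p" "b \<in> below_eq (er_le P) p" for a b
  proof -
    have refl: "(p, p) \<in> er_le P" "(q, q) \<in> er_le P"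
      using finitary_orderD(2)[OF er_le_finitary] pq by auto
    have le: "(u, p) \<in> er_le P" "(u, q) \<in> er_le P" "(p, u) \<notin> er_le P" "(q, u) \<notin> er_le P"
      if "u \<in> below_strict (er_le P) p" for u
    proof -
      show 1: "(u, p) \<in> er_le P" and 2: "(u, q) \<in> er_le P"
        using that pq(3) by (auto simp: below_strict_def)
      have "u \<noteq> p" "u \<noteq> q"
        using that pq(3) by (auto simp: below_strict_def)
      then show "(p, u) \<notin> er_le P" "(q, u) \<notin> er_le P"
        using 1 2 finitary_orderD(4)[OF er_le_finitary] by blast+
    qed
    show ?thesis
      using that np refl le unfolding lp by (auto simp: \<phi>_def)
  qed
  ultimately have "order_iso (principal_part (er_order P) p) (principal_part (er_order P) q) \<phi>"
    using pq(4) by (auto simp: order_iso_def principal_part_def \<phi>_def bij_betw_def)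
  then have "isomorphic (principal_part (er_order P) p) (principal_part (er_order P) q)"
    by (rule order_iso_isomorphic) (auto simp: principal_part_def)
  then have "isomorphic p q"
    using isomorphic_trans[OF isomorphic_trans[OF isomorphic_principal_er_order[OF pq(1)]]
        isomorphic_sym[OF isomorphic_principal_er_order[OF pq(2)]]] by simp
  then show "p = q"
    by (rule isomorphic_mem_eq[OF pq(1,2)])
qed

text \<open>The assumption \<open>min\<close> is exactly minimality at the new greatest element; at
  the old elements tightness is inherited from the order on \<open>P\<close>. The representative
  obtained has some copy of \<open>X\<close> strictly below it, and rigidity shows that this copy is
  \<open>X\<close>.\<close>

lemma ex_prime_above:
  assumes X: "down_closed P (er_le P) X" and fin: "finite X" and a: "insert a (rmax ` X) \<in> \<A>"
    and min: "\<And>Y. down_closed P (er_le P) Y \<Longrightarrow> Y \<subseteq> X \<Longrightarrow> insert a (rmax ` Y) \<in> \<A> \<Longrightarrow> Y = X"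
  shows "\<exists>p\<in>P. rmax p = a \<and> below_strict (er_le P) p = X"
proof -
  note D = finitary_orderD[OF er_le_finitary]
  have XP: "X \<subseteq> P"
    using X by (simp add: down_closed_def)
  have XD: "y \<in> X" if "x \<in> X" "(y, x) \<in> er_le P" for x y
    using X that by (auto simp: down_closed_def)
  \<comment> \<open>The realisation \<open>X\<close> with a new greatest element \<open>None\<close> labelled \<open>a\<close>.\<close>
  define C where "C = insert None (Some ` X)"
  define le where "le = {(u, v). u \<in> C \<and> v \<in> C \<and>
    (v = None \<or> (\<exists>x y. u = Some x \<and> v = Some y \<and> (x, y) \<in> er_le P))}"
  define \<rho> where "\<rho> = \<lparr> car = C, ord = le, lab = case_option a rmax \<rparr>"
  have \<rho>_simps [simp]: "car \<rho> = C" "ord \<rho> = le" "lab \<rho> = case_option a rmax"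
    by (simp_all add: \<rho>_def)
  have be: "below_eq le None = C" "\<And>x. x \<in> X \<Longrightarrow> below_eq le (Some x) = Some ` below_eq (er_le P) x"
    using XD by (auto simp: below_eq_def le_def C_def)
  have bs: "below_strict le None = Some ` X"
    "\<And>x. x \<in> X \<Longrightarrow> below_strict le (Some x) = Some ` below_strict (er_le P) x"
    using XD by (auto simp: below_strict_def le_def C_def)
  have F: "finitary_order C le"
  proof (rule finitary_orderI)
    show "(u, u) \<in> le" if "u \<in> C" for u
      using that D(2) XP by (auto simp: le_def C_def)
    show "(u, w) \<in> le" if "(u, v) \<in> le" "(v, w) \<in> le" for u v w
      using that D(3) by (auto simp: le_def)
    show "u = v" if "(u, v) \<in> le" "(v, u) \<in> le" for u v
      using that D(4) by (auto simp: le_def)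
    show "finite (below_eq le u)" if "u \<in> C" for u
      by (rule finite_subset[of _ C]) (use fin in \<open>auto simp: below_eq_def le_def C_def\<close>)
  qed (auto simp: le_def)
  have "is_realisation \<A> \<rho>"
  proof (rule is_realisationI[OF fam _ _ a])
    fix u assume "u \<in> car \<rho>"
    then consider "u = None" | x where "x \<in> X" "u = Some x"
      by (auto simp: C_def)
    then show "lab \<rho> ` below_eq (ord \<rho>) u \<in> \<A>"
    proof cases
      case 1
      then show ?thesis
        using a by (simp add: be C_def image_image)
    next
      case 2
      then show ?thesis
        using rmax_below_eq XP by (auto simp: be image_image)
    qed
  qed (use F in \<open>auto simp: C_def\<close>)
  moreover have dc: "down_closed P (er_le P) Y"
    if "down_closed C le (Some ` Y)" "Y \<subseteq> X" for Y
    unfolding down_closed_def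
  proof (intro conjI ballI allI impI)
    show "Y \<subseteq> P"
      using that(2) XP by blast
    fix x y assume x: "x \<in> Y" and yx: "(y, x) \<in> er_le P"
    then have "(Some y, Some x) \<in> le"
      using that(2) XD by (auto simp: le_def C_def)
    then have "Some y \<in> Some ` Y"
      using that(1) x unfolding down_closed_def by blast
    then show "y \<in> Y"
      by auto
  qed
  have "tight \<A> \<rho>"
    unfolding tight_def
  proof (intro conjI ballI allI impI; elim conjE)
    fix u Z
    assume u: "u \<in> car \<rho>" and Z: "down_closed (car \<rho>) (ord \<rho>) Z"
      "Z \<subseteq> below_strict (ord \<rho>) u" "insert (lab \<rho> u) (lab \<rho> ` Z) \<in> \<A>"
    have "Z \<subseteq> Some ` X"
      using Z(2) u XD by (auto simp: below_strict_def le_def C_def)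
    then obtain Y where Y: "Y \<subseteq> X" "Z = Some ` Y"
      by (auto simp: subset_image_iff)
    have dY: "down_closed P (er_le P) Y"
      using dc Y Z(1) by simp
    consider "u = None" | x where "x \<in> X" "u = Some x"
      using u by (auto simp: C_def)
    then show "Z = below_strict (ord \<rho>) u"
    proof cases
      case 1
      then have "Y = X"
        using min[OF dY Y(1)] Z(3) Y(2) by (simp add: image_image)
      then show ?thesis
        using 1 Y(2) by (simp add: bs)
    next
      case 2
      have "Y \<subseteq> below_strict (er_le P) x"
        using Z(2) 2 Y(2) by (auto simp: bs)
      moreover have "insert (rmax x) (rmax ` Y) \<in> \<A>"
        using Z(3) 2 Y(2) by (simp add: image_image)
      ultimately have "Y = below_strict (er_le P) x"
        using tight_minimal[OF tight_er_order, of x Y] dY 2 XP by auto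
      then show ?thesis
        using 2 Y(2) by (simp add: bs)
    qed
  next
    fix u v
    assume u: "u \<in> car \<rho>" and v: "v \<in> car \<rho>"
      and eq: "below_strict (ord \<rho>) u = below_strict (ord \<rho>) v" "lab \<rho> u = lab \<rho> v"
    \<comment> \<open>An old event lies strictly below the new top but not strictly below itself;
      this settles the mixed cases of uniqueness.\<close>
    have ne: "below_strict le None \<noteq> below_strict le (Some x)" if "x \<in> X" for x
    proof -
      have "Some x \<in> below_strict le None" "Some x \<notin> below_strict le (Some x)"
        using that by (auto simp: bs(1)) (auto simp: below_strict_def)
      then show ?thesis
        by blast
    qed
    show "u = v"
    proof (cases u; cases v)
      fix x y assume xy: "u = Some x" "v = Some y"
      then have "x \<in> X" "y \<in> X"
        using u v by (auto simp: C_def)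
      moreover from this have "below_strict (er_le P) x = below_strict (er_le P) y"
        using eq(1) xy by (simp add: bs inj_image_eq_iff)
      moreover have "rmax x = rmax y"
        using eq(2) xy by simp
      ultimately show ?thesis
        using tight_unique[OF tight_er_order, of x y] XP xy by auto
    qed (use u v eq(1) ne ne[symmetric] in \<open>auto simp: C_def\<close>)
  qed
  moreover have top: "is_greatest \<rho> None"
    by (auto simp: is_greatest_def le_def C_def)
  ultimately have "prime_extremal \<A> \<rho>"
    using tight_imp_extremal by (auto simp: prime_extremal_def)
  then obtain p where p: "p \<in> P" "isomorphic \<rho> p"
    using ex_representative by blast
  have F\<rho>: "finitary_order (car \<rho>) (ord \<rho>)"
    using F by simp
  \<comment> \<open>Composing with \<open>embed p\<close> gives an isomorphism
    \<open>\<theta>\<close> onto the down-set of \<open>p\<close> in \<open>P\<close>. It sends top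
    to top, so removing both tops leaves an isomorphism from \<open>X\<close> onto the strict
    down-set of \<open>p\<close>.\<close>
  obtain \<psi> where "order_iso \<rho> p \<psi>"
    using isomorphic_order_iso[OF p(2) F\<rho> finitary_mem[OF p(1)]] by blast
  then obtain \<theta> where \<theta>: "order_iso \<rho> (principal_part (er_order P) p) \<theta>"
    using order_iso_comp[OF _ order_iso_embed[OF p(1)]] by blast
  have rmax: "rmax p = a"
    using rmax_isomorphic[OF p(2) F\<rho> finitary_mem[OF p(1)] top] by simp
  have FP: "finitary_order (car (er_order P)) (ord (er_order P))"
    using er_le_finitary by simp
  have "(p, \<theta> None) \<in> er_le P" "(\<theta> None, p) \<in> er_le P"
    using order_iso_greatest[OF \<theta> top] is_greatest_principal[OF FP, of p] p(1)
    by (auto simp: is_greatest_def principal_part_def)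
  then have \<theta>p: "\<theta> None = p"
    using D(4) by blast
  have bij: "bij_betw \<theta> C (below_eq (er_le P) p)"
    using \<theta> by (simp add: order_iso_def principal_part_def)
  have "bij_betw \<theta> (C - {None}) (below_eq (er_le P) p - {\<theta> None})"
    using bij by (rule bij_betw_DiffI) (use bij in \<open>auto simp: C_def bij_betw_def\<close>)
  moreover have "C - {None} = Some ` X"
    by (auto simp: C_def)
  moreover have bsp: "below_eq (er_le P) p - {\<theta> None} = below_strict (er_le P) p"
    by (auto simp: \<theta>p below_eq_def below_strict_def)
  ultimately have "bij_betw \<theta> (Some ` X) (below_strict (er_le P) p)"
    by simp
  then have bij': "bij_betw (\<theta> \<circ> Some) X (below_strict (er_le P) p)"
    by (intro bij_betw_trans[where B = "Some ` X"]) (auto simp: bij_betw_def)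
  have "order_iso (restriction (er_order P) X) (restriction (er_order P) (below_strict (er_le P) p)) (\<theta> \<circ> Some)"
    unfolding order_iso_def
  proof (intro conjI ballI)
    show "bij_betw (\<theta> \<circ> Some) (car (restriction (er_order P) X))
        (car (restriction (er_order P) (below_strict (er_le P) p)))"
      using bij' by simp
  next
    fix x y assume "x \<in> car (restriction (er_order P) X)" "y \<in> car (restriction (er_order P) X)"
    then have xy: "x \<in> X" "y \<in> X"
      by auto
    then have C: "Some x \<in> C" "Some y \<in> C"
      by (auto simp: C_def)
    have "\<theta> (Some x) \<in> below_strict (er_le P) p" "\<theta> (Some y) \<in> below_strict (er_le P) p"
      using bij' xy by (auto simp: bij_betw_def)
    moreover have "(\<theta> (Some x), \<theta> (Some y)) \<in> er_le P \<longleftrightarrow> (x, y) \<in> er_le P"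
    proof -
      have "(\<theta> (Some x), \<theta> (Some y)) \<in> er_le P \<longleftrightarrow> (Some x, Some y) \<in> le"
        using \<theta> C bij_betw_apply[OF bij] by (simp add: order_iso_def principal_part_def)
      then show ?thesis
        using C by (simp add: le_def)
    qed
    ultimately show "((\<theta> \<circ> Some) x, (\<theta> \<circ> Some) y) \<in> ord (restriction (er_order P) (below_strict (er_le P) p))
        \<longleftrightarrow> (x, y) \<in> ord (restriction (er_order P) X)"
      using xy by simp
  next
    fix x assume "x \<in> car (restriction (er_order P) X)"
    then have "Some x \<in> C"
      by (auto simp: C_def)
    then show "lab (restriction (er_order P) (below_strict (er_le P) p)) ((\<theta> \<circ> Some) x)
        = lab (restriction (er_order P) X) x"
      using \<theta> by (fastforce simp: order_iso_def principal_part_def)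
  qed
  \<comment> \<open>Source and target are both down-closed parts of the same tight order, so
    rigidity makes the isomorphism the identity pointwise.\<close>
  then have "(\<theta> \<circ> Some) x = x" if "x \<in> X" for x
    using order_iso_rigid[OF FP tight_er_order _ _ _ that, of "below_strict (er_le P) p" "\<theta> \<circ> Some"]
      X down_closed_below_strict[OF er_le_finitary, of p] by simp
  then have "(\<theta> \<circ> Some) ` X = X"
    by force
  then have "below_strict (er_le P) p = X"
    using bij' by (simp add: bij_betw_def)
  then show ?thesis
    using p(1) rmax by blast
qed

end

subsection \<open>Configurations of event structures\<close>

lemma is_ese_finitary: "is_ese Q \<Longrightarrow> finitary_order (events Q) (causal Q)"
  by (simp add: is_ese_def prime_event_structure_def finitary_order_def below_eq_def)

lemma is_ese_Con:
  assumes "is_ese Q"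
  shows "Con Q \<noteq> {}" "\<forall>q\<in>events Q. {q} \<in> Con Q" "\<forall>X Y. Y \<subseteq> X \<and> X \<in> Con Q \<longrightarrow> Y \<in> Con Q"
    "\<forall>X p p'. X \<in> Con Q \<and> (p, p') \<in> causal Q \<and> p' \<in> X \<longrightarrow> X \<union> {p} \<in> Con Q"
  using assms unfolding is_ese_def prime_event_structure_def by - (elim conjE, assumption)+

lemma configurations_subset:
  "x \<in> configurations Q \<Longrightarrow> y \<subseteq> x \<Longrightarrow> down_closed (events Q) (causal Q) y \<Longrightarrow> y \<in> configurations Q"
  by (auto simp: configurations_def)

lemma below_eq_configuration:
  assumes Q: "is_ese Q" and q: "q \<in> events Q"
  shows "below_eq (causal Q) q \<in> configurations Q"
proof -
  note C = is_ese_Con[OF Q]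
  \<comment> \<open>\<open>q\<close> stays in the set throughout the induction, since consistency is
    known to survive the addition of an event only when the event lies below a member.\<close>
  have "insert q X \<in> Con Q" if "finite X" "X \<subseteq> below_eq (causal Q) q" for X
    using that
  proof (induction X rule: finite_induct)
    case empty
    then show ?case
      using C(2) q by simp
  next
    case (insert p X)
    then have "insert p (insert q X) \<in> Con Q"
      using C(4)[rule_format, of "insert q X" p q] by (simp add: below_eq_def)
    then show ?case
      by (simp add: insert_commute)
  qed
  then have "X \<in> Con Q" if "finite X" "X \<subseteq> below_eq (causal Q) q" for X
    using C(3)[rule_format, of X "insert q X"] that by blast
  then show ?thesis
    using down_closed_below_eq[OF is_ese_finitary[OF Q]] by (simp add: configurations_def)
qed

lemma Union_configurations:
  assumes "is_ese Q"
  shows "\<Union>(configurations Q) = events Q"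
proof (intro equalityI subsetI)
  fix q assume q: "q \<in> events Q"
  then have "q \<in> below_eq (causal Q) q"
    using finitary_orderD(2)[OF is_ese_finitary[OF assms]] by (simp add: below_eq_def)
  then show "q \<in> \<Union>(configurations Q)"
    using below_eq_configuration[OF assms q] by blast
qed (auto simp: configurations_def down_closed_def)

text \<open>An element whose principal down-set has the largest size is maximal in \<open>D\<close>;
  it is listed last, and what remains is still down-closed.\<close>

lemma ex_securing_chain:
  assumes F: "finitary_order R le" and "finite D" "down_closed R le D"
  shows "\<exists>es. set es = D \<and> (\<forall>i\<le>length es. down_closed R le (set (take i es)))"
  using assms(2,3)
proof (induction "card D" arbitrary: D)
  case 0
  then show ?case
    by (intro exI[of _ "[]"]) simp
next
  case (Suc n)
  note Dd = finitary_orderD[OF F]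
  have DR: "D \<subseteq> R"
    using Suc.prems by (simp add: down_closed_def)
  have "D \<noteq> {}"
    using Suc.hyps(2) by auto
  then have "Max ((\<lambda>e. card (below_eq le e)) ` D) \<in> (\<lambda>e. card (below_eq le e)) ` D"
    using Suc.prems(1) by (intro Max_in) auto
  then obtain m where m: "m \<in> D" "card (below_eq le m) = Max ((\<lambda>e. card (below_eq le e)) ` D)"
    by auto
  have max: "e = m" if e: "e \<in> D" "(m, e) \<in> le" for e
  proof (rule ccontr)
    assume "e \<noteq> m"
    then have "e \<notin> below_eq le m" "e \<in> below_eq le e"
      using e Dd(4)[of m e] Dd(2) DR by (auto simp: below_eq_def)
    moreover have "below_eq le m \<subseteq> below_eq le e"
      using e(2) Dd(3) by (auto simp: below_eq_def)
    ultimately have "card (below_eq le m) < card (below_eq le e)"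
      using Dd(7)[of e] e(1) DR by (intro psubset_card_mono) auto
    moreover have "card (below_eq le e) \<le> card (below_eq le m)"
      using m(2) e(1) Suc.prems(1) by simp
    ultimately show False
      by simp
  qed
  have "n = card (D - {m})"
    using Suc.hyps(2) m(1) Suc.prems(1) by simp
  moreover have "down_closed R le (D - {m})"
    using Suc.prems(2) max unfolding down_closed_def by blast
  ultimately obtain es where es: "set es = D - {m}" "\<forall>i\<le>length es. down_closed R le (set (take i es))"
    using Suc.hyps(1) Suc.prems(1) by blast
  have S: "set (es @ [m]) = D"
    using es(1) m(1) by auto
  moreover have "down_closed R le (set (take i (es @ [m])))" if "i \<le> length (es @ [m])" for i
  proof (cases "i \<le> length es")
    case False
    then show ?thesis
      using that S Suc.prems(2) by simp
  qed (use es(2) in simp)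
  ultimately show ?case
    by blast
qed

text \<open>For unions, a finite subset is covered by finitely many members, which compatibility
  places in one configuration. The chain leading to \<open>e\<close> enumerates its strict down-set
  and then adds \<open>e\<close>.\<close>

lemma equivalence_family_I_ef:
  assumes Q: "is_ese Q"
  shows "equivalence_family (I_ef Q)"
proof -
  note F = is_ese_finitary[OF Q]
  have "{} \<in> Con Q"
    using is_ese_Con(1,3)[OF Q] by (meson empty_subsetI equals0I)
  then have "{} \<in> configurations Q"
    by (auto simp: configurations_def down_closed_def)
  moreover have "\<Union>X \<in> configurations Q"
    if X: "X \<subseteq> configurations Q" "finitely_compatible (configurations Q) X" for X
  proof -
    have "down_closed (events Q) (causal Q) (\<Union>X)"
      using X(1) unfolding down_closed_def configurations_def by blast
    moreover have "Y \<in> Con Q" if Y: "Y \<subseteq> \<Union>X" "finite Y" for Y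
    proof -
      obtain Z where Z: "finite Z" "Z \<subseteq> X" "Y \<subseteq> \<Union>Z"
        using finite_subset_Union[OF Y(2,1)] by blast
      then obtain y where y: "y \<in> configurations Q" "\<forall>z\<in>Z. z \<subseteq> y"
        using X(2) unfolding finitely_compatible_def by blast
      then have "Y \<subseteq> y"
        using Z(3) by blast
      then show ?thesis
        using y(1) Y(2) by (simp add: configurations_def)
    qed
    ultimately show ?thesis
      by (simp add: configurations_def)
  qed
  moreover have "\<exists>es. es \<noteq> [] \<and> set es \<subseteq> x \<and> last es = e \<and>
      (\<forall>i\<le>length es. set (take i es) \<in> configurations Q)"
    if x: "x \<in> configurations Q" and e: "e \<in> x" for x e
  proof -
    have ee: "e \<in> events Q" and sub: "below_eq (causal Q) e \<subseteq> x"
      using x e by (auto simp: configurations_def down_closed_def below_eq_def)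
    note ins = below_eq_insert[OF F ee]
    have "finite (below_strict (causal Q) e)"
      using finitary_orderD(7)[OF F ee] ins by simp
    then obtain es where es: "set es = below_strict (causal Q) e"
      "\<forall>i\<le>length es. down_closed (events Q) (causal Q) (set (take i es))"
      using ex_securing_chain[OF F _ down_closed_below_strict[OF F]] by blast
    have S: "set (es @ [e]) = below_eq (causal Q) e"
      using es(1) ins by simp
    have "set (take i (es @ [e])) \<in> configurations Q" if i: "i \<le> length (es @ [e])" for i
    proof (cases "i \<le> length es")
      case True
      have "set (take i es) \<subseteq> x"
        using set_take_subset[of i es] es(1) ins sub by auto
      then show ?thesis
        using True es(2) by (simp add: configurations_subset[OF x])
    next
      case False
      then show ?thesis
        using i S below_eq_configuration[OF Q ee] by simp
    qed
    then show ?thesis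
      using S sub by (intro exI[of _ "es @ [e]"]) auto
  qed
  ultimately have "configuration_family (configurations Q)"
    unfolding configuration_family_def by blast
  then show ?thesis
    using Q by (simp add: equivalence_family_def I_ef_def Union_configurations is_ese_def)
qed

subsection \<open>The counit and its universal property\<close>

lemma down_closed_down_closure:
  assumes F: "finitary_order R le"
  shows "down_closed R le (down_closure le X)"
  using finitary_orderD(3,5)[OF F] unfolding down_closed_def down_closure_def by blast

lemma down_closure_insert_below:
  assumes F: "finitary_order R le" and "(p, p') \<in> le" "p' \<in> X"
  shows "down_closure le (insert p X) = down_closure le X"
  using finitary_orderD(3)[OF F] assms(2,3) unfolding down_closure_def by blast

locale equivalence_representatives = representatives \<A> P
  for \<A> :: "'a set set" and P :: "('r::infinite, 'a) realisation set" +
  fixes E :: "'a rel"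
  assumes equiv: "equiv (\<Union>\<A>) E"
begin

section \<open>\<open>er\<close> as an event structure with equivalence, and its
  configurations\<close>

lemma rmax_mem: "p \<in> P \<Longrightarrow> rmax p \<in> \<Union>\<A>"
  using rmax_below_eq[of p] finitary_orderD(2)[OF er_le_finitary, of p]
  unfolding below_eq_def by blast

lemma er_simps [simp]:
  "events (er (\<A>, E) P) = P" "causal (er (\<A>, E) P) = er_le P"
  "Con (er (\<A>, E) P) = {X. finite X \<and> X \<subseteq> P \<and> rmax ` down_closure (er_le P) X \<in> \<A>}"
  "eqv (er (\<A>, E) P) = {(p\<^sub>1, p\<^sub>2). p\<^sub>1 \<in> P \<and> p\<^sub>2 \<in> P \<and> (rmax p\<^sub>1, rmax p\<^sub>2) \<in> E}"
  by (simp_all add: er_def)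

lemma is_ese_er: "is_ese (er (\<A>, E) P)"
proof -
  have "{} \<in> Con (er (\<A>, E) P)"
    using configuration_family_empty[OF fam] by (simp add: down_closure_def)
  then have nonempty: "Con (er (\<A>, E) P) \<noteq> {}"
    by blast
  have singleton: "{p} \<in> Con (er (\<A>, E) P)" if "p \<in> P" for p
    using rmax_below_eq[OF that] that by (simp add: down_closure_def below_eq_def)
  have subset: "Y \<in> Con (er (\<A>, E) P)" if "Y \<subseteq> X \<and> X \<in> Con (er (\<A>, E) P)" for X Y
  proof -
    have "down_closure (er_le P) Y \<subseteq> down_closure (er_le P) X"
      using that by (auto simp: down_closure_def)
    moreover have "rmax ` down_closure (er_le P) X \<in> \<A>"
      using that by simp
    ultimately have "rmax ` down_closure (er_le P) Y \<in> \<A>"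
      using rmax_down_closed[OF down_closed_down_closure[OF er_le_finitary]] image_mono by metis
    moreover have "finite Y" "Y \<subseteq> P"
      using that finite_subset by auto
    ultimately show ?thesis
      by simp
  qed
  have below: "X \<union> {p} \<in> Con (er (\<A>, E) P)"
    if X: "X \<in> Con (er (\<A>, E) P) \<and> (p, p') \<in> er_le P \<and> p' \<in> X" for X p p'
  proof -
    have p: "(p, p') \<in> er_le P" "p' \<in> X"
      using X by auto
    then show ?thesis
      using X down_closure_insert_below[OF er_le_finitary p] finitary_orderD(5)[OF er_le_finitary p(1)]
      by simp
  qed
  have "prime_event_structure P (er_le P) (Con (er (\<A>, E) P))"
    unfolding prime_event_structure_def
  proof (intro conjI allI ballI impI)
    show "partial_order_on P (er_le P)"
      using er_le_finitary by (simp add: finitary_order_def)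
    show "finite {p'. (p', p) \<in> er_le P}" if "p \<in> P" for p
      using finitary_orderD(7)[OF er_le_finitary that] by (simp add: below_eq_def)
  qed (fact nonempty, simp, simp, fact singleton, fact subset, fact below)
  moreover have "equiv P (eqv (er (\<A>, E) P))"
  proof (rule equivI)
    have E: "refl_on (\<Union>\<A>) E" "sym E" "trans E"
      using equiv by (auto elim: equivE)
    show "eqv (er (\<A>, E) P) \<subseteq> P \<times> P"
      by auto
    show "refl_on P (eqv (er (\<A>, E) P))"
      using refl_onD[OF E(1) rmax_mem] by (simp add: refl_on_def)
    show "sym (eqv (er (\<A>, E) P))"
      using E(2) by (auto simp: sym_def)
    show "trans (eqv (er (\<A>, E) P))"
      by (rule transI) (auto intro: transD[OF E(3)])
  qed
  ultimately show ?thesis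
    by (simp add: is_ese_def)
qed

text \<open>Consistency of the finite subsets of \<open>x\<close> makes the label sets of its
  principal down-sets finitely compatible, and their union is \<open>rmax\<close> applied to
  \<open>x\<close>. Conversely, the labels of \<open>x\<close> bound those of the down-closure of
  each finite subset.\<close>

lemma er_configurations_iff:
  "x \<in> configurations (er (\<A>, E) P) \<longleftrightarrow> down_closed P (er_le P) x \<and> rmax ` x \<in> \<A>"
proof
  assume x: "x \<in> configurations (er (\<A>, E) P)"
  then have dc: "down_closed P (er_le P) x"
    and Con: "\<And>X. X \<subseteq> x \<Longrightarrow> finite X \<Longrightarrow> rmax ` down_closure (er_le P) X \<in> \<A>"
    by (auto simp: configurations_def)
  let ?X = "(\<lambda>p. rmax ` below_eq (er_le P) p) ` x"
  have xP: "x \<subseteq> P"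
    using dc by (simp add: down_closed_def)
  have "finitely_compatible \<A> ?X"
    unfolding finitely_compatible_def
  proof (intro allI impI, elim conjE)
    fix Z assume "Z \<subseteq> ?X" "finite Z"
    then obtain X where X: "X \<subseteq> x" "finite X" "Z = (\<lambda>p. rmax ` below_eq (er_le P) p) ` X"
      using finite_subset_image by metis
    have "\<forall>z\<in>Z. z \<subseteq> rmax ` down_closure (er_le P) X"
      unfolding X(3) by (auto simp: down_closure_def below_eq_def)
    then show "\<exists>y\<in>\<A>. \<forall>z\<in>Z. z \<subseteq> y"
      using Con[OF X(1,2)] by blast
  qed
  moreover have "?X \<subseteq> \<A>"
    using rmax_below_eq xP by blast
  ultimately have "\<Union>?X \<in> \<A>"
    using fam by (simp add: configuration_family_def)
  moreover have "\<Union>?X = rmax ` x"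
  proof (intro equalityI subsetI)
    fix a assume "a \<in> rmax ` x"
    then obtain p where "p \<in> x" "a = rmax p"
      by blast
    moreover have "p \<in> below_eq (er_le P) p"
      using finitary_orderD(2)[OF er_le_finitary] xP \<open>p \<in> x\<close> by (auto simp: below_eq_def)
    ultimately show "a \<in> \<Union>?X"
      by blast
  qed (use dc in \<open>auto simp: down_closed_def below_eq_def\<close>)
  ultimately show "down_closed P (er_le P) x \<and> rmax ` x \<in> \<A>"
    using dc by simp
next
  assume x: "down_closed P (er_le P) x \<and> rmax ` x \<in> \<A>"
  then have xP: "x \<subseteq> P"
    by (simp add: down_closed_def)
  have "rmax ` down_closure (er_le P) X \<in> \<A>" if "X \<subseteq> x" for X
  proof (rule rmax_down_closed[OF down_closed_down_closure[OF er_le_finitary]])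
    show "rmax ` down_closure (er_le P) X \<subseteq> rmax ` x"
      using that x by (auto simp: down_closed_def down_closure_def)
  qed (use x in simp)
  then show "x \<in> configurations (er (\<A>, E) P)"
    using x xP by (auto simp: configurations_def)
qed

section \<open>The counit and the construction of lifts\<close>

lemma pimage_er_counit: "x \<subseteq> P \<Longrightarrow> pimage (er_counit P) x = rmax ` x"
  by (auto simp: pimage_def er_counit_def)

lemma ef_map_er_counit: "ef_map (I_ef (er (\<A>, E) P)) (\<A>, E) (er_counit P)"
proof -
  have "equivalence_family (configurations (er (\<A>, E) P), eqv (er (\<A>, E) P))"
    using equivalence_family_I_ef[OF is_ese_er] by (simp add: I_ef_def)
  moreover have "equivalence_family (\<A>, E)"
    using fam equiv by (simp add: equivalence_family_def)
  moreover have "dom (er_counit P) \<subseteq> \<Union>(configurations (er (\<A>, E) P))"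
    unfolding Union_configurations[OF is_ese_er] by (auto simp: er_counit_def split: if_splits)
  moreover have "ran (er_counit P) \<subseteq> \<Union>\<A>"
    using rmax_mem by (auto simp: er_counit_def ran_def split: if_splits)
  moreover have "pimage (er_counit P) x \<in> \<A>" and "x \<subseteq> P" if "x \<in> configurations (er (\<A>, E) P)" for x
    using that pimage_er_counit unfolding er_configurations_iff by (auto simp: down_closed_def)
  ultimately show ?thesis
    unfolding ef_map_def I_ef_def by (auto simp: er_counit_def subset_iff)
qed

text \<open>The inclusion of strict down-sets is the invariant that the recursion carries: it makes
  the values already chosen below \<open>q\<close> a down-closed set, so that a new prime can be
  built over a part of it.\<close>

lemma ex_lift:
  fixes Q :: "'q ese"
  assumes Q: "is_ese Q" and f: "ef_map (I_ef Q) (\<A>, E) f"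
  shows "\<exists>h. \<forall>q. case f q of None \<Rightarrow> h q = None
    | Some a \<Rightarrow> \<exists>p\<in>P. h q = Some p \<and> rmax p = a \<and>
        below_strict (er_le P) p \<subseteq> pimage h (below_strict (causal Q) q)"
proof -
  note F = is_ese_finitary[OF Q]
  let ?S = "\<lambda>h q r. case f q of None \<Rightarrow> r = None
    | Some a \<Rightarrow> \<exists>p\<in>P. r = Some p \<and> rmax p = a \<and>
        below_strict (er_le P) p \<subseteq> pimage h (below_strict (causal Q) q)"
  have "\<exists>h. \<forall>q. ?S h q (h q)"
  \<comment> \<open>The requirement at \<open>q\<close> consults \<open>h\<close> only strictly
    below \<open>q\<close>, so a choice satisfying it can be made once the earlier values are fixed,
    without naming a canonical minimal set.\<close>
  proof (rule dependent_wf_choice[OF wf_finitary_order[OF F], where P = ?S])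
    fix h h' :: "'q \<Rightarrow> ('r, 'a) realisation option" and q r
    assume "\<And>z. (z, q) \<in> {(a, b). (a, b) \<in> causal Q \<and> a \<noteq> b} \<Longrightarrow> h z = h' z"
    then have "pimage h (below_strict (causal Q) q) = pimage h' (below_strict (causal Q) q)"
      by (auto simp: pimage_def below_strict_def)
    then show "?S h q r = ?S h' q r"
      by (simp split: option.split)
  next
    fix q and h :: "'q \<Rightarrow> ('r, 'a) realisation option"
    assume IH: "\<And>y. (y, q) \<in> {(a, b). (a, b) \<in> causal Q \<and> a \<noteq> b} \<Longrightarrow> ?S h y (h y)"
    show "\<exists>r. ?S h q r"
    proof (cases "f q")
      case None
      then show ?thesis
        by simp
    next
      case (Some a)
      have q: "q \<in> events Q"
        using f Some Union_configurations[OF Q] by (auto simp: ef_map_def I_ef_def)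
      define Y where "Y = pimage h (below_strict (causal Q) q)"
      have Yh: "p \<in> P \<and> f v = Some (rmax p) \<and>
          below_strict (er_le P) p \<subseteq> pimage h (below_strict (causal Q) v)"
        if "v \<in> below_strict (causal Q) q" "h v = Some p" for v p
        using IH[of v] that by (auto simp: below_strict_def split: option.splits)
      have hf: "\<exists>p. h v = Some p" if "v \<in> below_strict (causal Q) q" "f v = Some b" for v b
        using IH[of v] that by (auto simp: below_strict_def)
      have dY: "down_closed P (er_le P) Y"
        unfolding down_closed_def
      proof (intro conjI ballI allI impI)
        show "Y \<subseteq> P"
          using Yh by (auto simp: Y_def pimage_def)
        fix p p' assume "p \<in> Y" and p': "(p', p) \<in> er_le P"
        then obtain v where v: "v \<in> below_strict (causal Q) q" "h v = Some p"
          by (auto simp: Y_def pimage_def)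
        show "p' \<in> Y"
        proof (cases "p' = p")
          case False
          then have "p' \<in> below_strict (er_le P) p"
            using p' by (simp add: below_strict_def)
          then have "p' \<in> pimage h (below_strict (causal Q) v)"
            using Yh[OF v] by blast
          moreover have "below_strict (causal Q) v \<subseteq> below_strict (causal Q) q"
            using v(1) down_closed_below_strict[OF F, of q]
            by (auto simp: down_closed_def below_strict_def[of _ v])
          ultimately show ?thesis
            by (auto simp: Y_def pimage_def)
        qed (use \<open>p \<in> Y\<close> in simp)
      qed
      have "finite (below_strict (causal Q) q)"
        using finitary_orderD(7)[OF F q] below_eq_insert[OF F q] by simp
      moreover have "Y \<subseteq> (\<lambda>v. the (h v)) ` below_strict (causal Q) q"
        by (force simp: Y_def pimage_def)
      ultimately have finY: "finite Y"
        using finite_surj by blast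
      have "rmax ` Y = pimage f (below_strict (causal Q) q)"
      proof (intro equalityI subsetI)
        fix b assume "b \<in> pimage f (below_strict (causal Q) q)"
        then obtain v where v: "v \<in> below_strict (causal Q) q" "f v = Some b"
          by (auto simp: pimage_def)
        then obtain p where p: "h v = Some p"
          using hf by blast
        then have "p \<in> Y"
          using v(1) by (auto simp: Y_def pimage_def)
        moreover have "rmax p = b"
          using Yh[OF v(1) p] v(2) by simp
        ultimately show "b \<in> rmax ` Y"
          by blast
      qed (use Yh in \<open>auto simp: Y_def pimage_def\<close>)
      then have "insert a (rmax ` Y) = pimage f (below_eq (causal Q) q)"
        unfolding below_eq_insert[OF F q] using Some by (auto simp: pimage_def)
      moreover have "pimage f (below_eq (causal Q) q) \<in> \<A>"
        using f below_eq_configuration[OF Q q] by (simp add: ef_map_def I_ef_def)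
      ultimately have aY: "insert a (rmax ` Y) \<in> \<A>"
        by simp
      \<comment> \<open>Candidates for the strict down-set of \<open>h q\<close>. There are finitely
        many because \<open>Y\<close> is finite, and \<open>Y\<close> is one of them because
        \<open>f\<close> maps the configuration of events up to \<open>q\<close> to a member of
        \<open>\<A>\<close>.\<close>
      let ?M = "{X. down_closed P (er_le P) X \<and> X \<subseteq> Y \<and> insert a (rmax ` X) \<in> \<A>}"
      have "finite ?M"
        using finY by (rule finite_subset[rotated, OF finite_Pow_iff[THEN iffD2]]) auto
      moreover have "?M \<noteq> {}"
        using dY aY by blast
      ultimately have "\<exists>X\<in>?M. \<forall>Z\<in>?M. Z \<subseteq> X \<longrightarrow> X = Z"
        by (rule finite_has_minimal)
      then obtain X where X: "X \<in> ?M" "\<forall>Z\<in>?M. Z \<subseteq> X \<longrightarrow> X = Z"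
        by (rule bexE)
      have "\<exists>p\<in>P. rmax p = a \<and> below_strict (er_le P) p = X"
      proof (rule ex_prime_above)
        show "finite X"
          using X(1) finY finite_subset by blast
        fix Z assume "down_closed P (er_le P) Z" "Z \<subseteq> X" "insert a (rmax ` Z) \<in> \<A>"
        then have "Z \<in> ?M"
          using X(1) by auto
        then show "Z = X"
          using X(2) \<open>Z \<subseteq> X\<close> by (metis (no_types, lifting))
      qed (use X(1) in auto)
      then obtain p where "p \<in> P" "rmax p = a" "below_strict (er_le P) p = X"
        by blast
      then show ?thesis
        using X(1) Some by (intro exI[of _ "Some p"]) (auto simp: Y_def)
    qed
  qed
  then show ?thesis .
qed

text \<open>Equivalence on \<open>P\<close> is pulled back along \<open>rmax\<close>, and
  \<open>h q\<close> has label \<open>f q\<close>, so the conditions on equivalence transfer from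
  \<open>f\<close>. The invariant of the lift makes images of configurations down-closed. For
  uniqueness it suffices to compare labels of \<open>h' q\<close> and \<open>h q\<close>.\<close>

lemma er_universal:
  assumes Q: "is_ese Q" and f: "ef_map (I_ef Q) (\<A>, E) f"
  shows "\<exists>h. ese_map Q (er (\<A>, E) P) h \<and> f = er_counit P \<circ>\<^sub>m h \<and>
    (\<forall>h'. ese_map Q (er (\<A>, E) P) h' \<and> maps_equiv E f (er_counit P \<circ>\<^sub>m h') \<longrightarrow>
      maps_equiv (eqv (er (\<A>, E) P)) h' h)"
proof -
  obtain h where h: "\<forall>q. case f q of None \<Rightarrow> h q = None
    | Some a \<Rightarrow> \<exists>p\<in>P. h q = Some p \<and> rmax p = a \<and>
        below_strict (er_le P) p \<subseteq> pimage h (below_strict (causal Q) q)"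
    using ex_lift[OF assms] by blast
  have hN: "h q = None \<longleftrightarrow> f q = None" for q
    using h[rule_format, of q] by (auto split: option.splits)
  have hS: "p \<in> P \<and> f q = Some (rmax p) \<and>
      below_strict (er_le P) p \<subseteq> pimage h (below_strict (causal Q) q)" if "h q = Some p" for p q
    using h[rule_format, of q] that by (auto split: option.splits)
  have fh: "f = er_counit P \<circ>\<^sub>m h"
  proof
    fix q show "f q = (er_counit P \<circ>\<^sub>m h) q"
    proof (cases "h q")
      case None
      then show ?thesis
        using hN by simp
    next
      case (Some p)
      then show ?thesis
        using hS[OF Some] by (simp add: er_counit_def)
    qed
  qed
  have fm: "dom f \<subseteq> \<Union>(configurations Q)"
    "\<And>a b. (a, b) \<in> eqv Q \<Longrightarrow> rel_option (\<lambda>b\<^sub>1 b\<^sub>2. (b\<^sub>1, b\<^sub>2) \<in> E) (f a) (f b)"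
    "\<And>x. x \<in> configurations Q \<Longrightarrow> pimage f x \<in> \<A>"
    "\<And>x a b c d. x \<in> configurations Q \<Longrightarrow> a \<in> x \<Longrightarrow> b \<in> x \<Longrightarrow> f a = Some c \<Longrightarrow> f b = Some d \<Longrightarrow>
      (c, d) \<in> E \<Longrightarrow> (a, b) \<in> eqv Q"
    using f unfolding ef_map_def I_ef_def prod.case by - (elim conjE, blast)+
  have dom: "dom h \<subseteq> \<Union>(configurations Q)"
    using fm(1) hN by (auto simp: dom_def)
  have ran: "ran h \<subseteq> \<Union>(configurations (er (\<A>, E) P))"
    unfolding Union_configurations[OF is_ese_er] using hS by (auto simp: ran_def)
  have pres: "rel_option (\<lambda>b\<^sub>1 b\<^sub>2. (b\<^sub>1, b\<^sub>2) \<in> eqv (er (\<A>, E) P)) (h a) (h b)"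
    if "(a, b) \<in> eqv Q" for a b
  proof (cases "h a"; cases "h b")
    fix p p' assume "h a = Some p" "h b = Some p'"
    then show ?thesis
      using fm(2)[OF that] hS by auto
  qed (use fm(2)[OF that] hN[of a] hN[of b] in auto)
  have conf: "pimage h x \<in> configurations (er (\<A>, E) P)" if x: "x \<in> configurations Q" for x
    unfolding er_configurations_iff
  proof
    show "down_closed P (er_le P) (pimage h x)"
      unfolding down_closed_def
    proof (intro conjI ballI allI impI)
      show "pimage h x \<subseteq> P"
        using hS by (auto simp: pimage_def)
      fix p p' assume "p \<in> pimage h x" and p': "(p', p) \<in> er_le P"
      then obtain q where q: "q \<in> x" "h q = Some p"
        by (auto simp: pimage_def)
      show "p' \<in> pimage h x"
      proof (cases "p' = p")
        case False
        then have "p' \<in> pimage h (below_strict (causal Q) q)"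
          using hS[OF q(2)] p' by (auto simp: below_strict_def)
        moreover have "below_strict (causal Q) q \<subseteq> x"
          using x q(1) by (auto simp: configurations_def down_closed_def below_strict_def)
        ultimately show ?thesis
          by (auto simp: pimage_def)
      qed (use \<open>p \<in> pimage h x\<close> in simp)
    qed
    \<comment> \<open>By the characterisation of configurations only the labels remain to be tested,
      and these are the image of \<open>x\<close> under \<open>f\<close>.\<close>
    then have "rmax ` pimage h x = pimage f x"
      using fh by (simp add: pimage_comp pimage_er_counit down_closed_def)
    then show "rmax ` pimage h x \<in> \<A>"
      using fm(3)[OF x] by simp
  qed
  have reflect: "(a, b) \<in> eqv Q" if "x \<in> configurations Q" "a \<in> x" "b \<in> x" "h a = Some p" "h b = Some p'"
    "(p, p') \<in> eqv (er (\<A>, E) P)" for x a b p p'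
    using fm(4)[OF that(1-3)] hS[OF that(4)] hS[OF that(5)] that(6) by simp
  have "ef_map (I_ef Q) (I_ef (er (\<A>, E) P)) h"
    unfolding ef_map_def I_ef_def prod.case
  proof (intro conjI allI ballI impI)
    show "equivalence_family (configurations Q, eqv Q)"
      using equivalence_family_I_ef[OF Q] by (simp add: I_ef_def)
    show "equivalence_family (configurations (er (\<A>, E) P), eqv (er (\<A>, E) P))"
      using equivalence_family_I_ef[OF is_ese_er] by (simp add: I_ef_def)
  qed (fact dom, fact ran, fact pres, fact conf, use reflect in blast)
  then have "ese_map Q (er (\<A>, E) P) h"
    using Q is_ese_er by (simp add: ese_map_def)
  moreover have "maps_equiv (eqv (er (\<A>, E) P)) h' h"
    if h': "ese_map Q (er (\<A>, E) P) h'" "maps_equiv E f (er_counit P \<circ>\<^sub>m h')" for h'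
    unfolding maps_equiv_def
  proof
    fix q
    have "ran h' \<subseteq> P"
      using h'(1) Union_configurations[OF is_ese_er] by (simp add: ese_map_def ef_map_def I_ef_def)
    then have hP: "p \<in> P" if "h' q = Some p" for p
      using that by (auto simp: ran_def)
    have rel: "rel_option (\<lambda>b\<^sub>1 b\<^sub>2. (b\<^sub>1, b\<^sub>2) \<in> E) (f q) ((er_counit P \<circ>\<^sub>m h') q)"
      using h'(2) by (simp add: maps_equiv_def)
    have symE: "(b, a) \<in> E" if "(a, b) \<in> E" for a b
      using equiv that by (meson equivE symD)
    show "rel_option (\<lambda>b\<^sub>1 b\<^sub>2. (b\<^sub>1, b\<^sub>2) \<in> eqv (er (\<A>, E) P)) (h' q) (h q)"
    proof (cases "h' q")
      case None
      then show ?thesis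
        using rel hN[of q] by simp
    next
      case (Some p')
      then have p': "p' \<in> P" "(er_counit P \<circ>\<^sub>m h') q = Some (rmax p')"
        using hP by (simp_all add: er_counit_def)
      then obtain b where b: "f q = Some b" "(b, rmax p') \<in> E"
        using rel by (cases "f q") auto
      then obtain p where p: "h q = Some p"
        using hN[of q] by (cases "h q") auto
      then show ?thesis
        using hS[OF p] b Some p'(1) symE by simp
    qed
  qed
  ultimately show ?thesis
    using fh by blast
qed

end

theorem theorem5p2:
  fixes \<A> :: "'a set set" and E :: "'a rel"
    and P :: "('r::infinite, 'a) realisation set"
  assumes "equivalence_family (\<A>, E)"
    and "is_choice_of_representatives \<A> P"
  shows "ef_map (I_ef (er (\<A>, E) P)) (\<A>, E) (er_counit P) \<and>
    (\<forall>(Q :: 'q ese) f. is_ese Q \<and> ef_map (I_ef Q) (\<A>, E) f \<longrightarrow>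
      (\<exists>h. ese_map Q (er (\<A>, E) P) h \<and> f = er_counit P \<circ>\<^sub>m h \<and>
        (\<forall>h'. ese_map Q (er (\<A>, E) P) h' \<and> maps_equiv E f (er_counit P \<circ>\<^sub>m h') \<longrightarrow>
          maps_equiv (eqv (er (\<A>, E) P)) h' h)))"
proof -
  interpret equivalence_representatives \<A> P E
    using assms by unfold_locales (simp_all add: equivalence_family_def)
  show ?thesis
    using ef_map_er_counit er_universal by blast
qed

end
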